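(* Let $G=(V,E)$ be a finite, connected and symmetric weighted graph with vertex measure $\mu$, let $h_+,h_-:V\to\mathbb{R}$ with $h_+\not\equiv0$ and $h_-\not\equiv0$, and let $c\in\mathbb{R}$. Then the topological degree $d_{h_+,h_-,c}$ of the sinh-Gordon equation $-\Delta u=h_+e^{u}+h_-e^{-u}-c$ is given by $$d_{h_+,h_-,c}=\begin{cases}(-1)^{\#V_0}, & \text{if } \{x\in V:h_+(x)>0\}=\{x\in V:h_-(x)<0\}=:V_0,\\ 0,&\text{otherwise,}\end{cases}$$ where $\#V_0$ denotes the number of elements of $V_0$ (and $V_0$ may be empty).
   Context: A finite, connected and symmetric graph $G=(V,E)$ has a finite vertex set $V$ and symmetric edge weights $\omega_{xy}=\omega_{yx}\ge 0$ with $\omega_{xy}>0$ if and only if $x\sim y$ (i.e. $xy\in E$); connected means that any two vertices are joined by a path of edges. The vertex measure is a positive function $\mu:V\to(0,\infty)$, $x\mapsto\mu_x$. The Laplacian acting on $u:V\to\mathbb{R}$ is $$\Delta u(x)=\frac{1}{\mu_x}\sum_{y\sim x}\omega_{xy}\,(u(y)-u(x)).$$ $L^\infty(V)$ is the finite-dimensional space of all functions $V\to\mathbb{R}$ with the norm $\max_V|u|$, and $B_R^{L^\infty(V)}$ is its open ball of radius $R$ centered at $0$. Define $F_{h_+,h_-,c}:L^\infty(V)\to L^\infty(V)$ by $$F_{h_+,h_-,c}(u)=-\Delta u-h_+e^{u}-h_-e^{-u}+c .$$ When $h_+\not\equiv0$ and $h_-\not\equiv0$, all zeros of $F_{h_+,h_-,c}$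 lie in a fixed bounded ball, so the Brouwer degree $\deg(F_{h_+,h_-,c},B_R^{L^\infty(V)},0)$ is well defined and independent of $R$ for $R$ large; the topological degree is $$d_{h_+,h_-,c}=\lim_{R\to\infty}\deg\left(F_{h_+,h_-,c},B_R^{L^\infty(V)},0\right).$$ *)

theory Defs
  imports "HOL-Analysis.Analysis"
begin

section \<open>Finite weighted graphs\<close>

text \<open>The vertex set is the whole of a finite type \<open>'v\<close> (so it is nonempty), and \<open>L\<^sup>\<infinity>(V)\<close> is
  \<open>real ^ 'v\<close> with the norm \<^const>\<open>infnorm\<close>. Loops are not excluded; they contribute nothing
  to the Laplacian.\<close>

locale weighted_graph =
  fixes E :: "('v::finite \<times> 'v) set"
    and \<omega> :: "'v \<Rightarrow> 'v \<Rightarrow> real"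
    and \<mu> :: "'v \<Rightarrow> real"
  assumes weight_sym: "\<omega> x y = \<omega> y x"
    and weight_nonneg: "\<omega> x y \<ge> 0"
    and weight_pos_iff: "\<omega> x y > 0 \<longleftrightarrow> (x, y) \<in> E"
    and connected: "(x, y) \<in> E\<^sup>*"
    and measure_pos: "\<mu> x > 0"

definition laplacian ::
  "('v::finite \<times> 'v) set \<Rightarrow> ('v \<Rightarrow> 'v \<Rightarrow> real) \<Rightarrow> ('v \<Rightarrow> real) \<Rightarrow> real ^ 'v \<Rightarrow> real ^ 'v"
  where "laplacian E \<omega> \<mu> u = (\<chi> x. (1 / \<mu> x) * (\<Sum>y | (x, y) \<in> E. \<omega> x y * (u $ y - u $ x)))"

definition sinh_gordon_map ::
  "('v::finite \<times> 'v) set \<Rightarrow> ('v \<Rightarrow> 'v \<Rightarrow> real) \<Rightarrow> ('v \<Rightarrow> real) \<Rightarrow>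
     ('v \<Rightarrow> real) \<Rightarrow> ('v \<Rightarrow> real) \<Rightarrow> real \<Rightarrow> real ^ 'v \<Rightarrow> real ^ 'v"
  where "sinh_gordon_map E \<omega> \<mu> hp hm c u =
    (\<chi> x. - (laplacian E \<omega> \<mu> u $ x) - hp x * exp (u $ x) - hm x * exp (- (u $ x)) + c)"

definition Linf_ball :: "real \<Rightarrow> (real ^ 'v::finite) set"
  where "Linf_ball R = {u. infnorm u < R}"


section \<open>The Brouwer degree\<close>

definition C2_on :: "('a::real_normed_vector \<Rightarrow> 'b::real_normed_vector) \<Rightarrow> 'a set \<Rightarrow> bool"
  where "C2_on g S \<longleftrightarrow>
    (\<exists>(g' :: 'a \<Rightarrow> 'a \<Rightarrow>\<^sub>L 'b) (g'' :: 'a \<Rightarrow> 'a \<Rightarrow>\<^sub>L 'a \<Rightarrow>\<^sub>L 'b).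
       (\<forall>x\<in>S. (g has_derivative blinfun_apply (g' x)) (at x)) \<and>
       (\<forall>x\<in>S. (g' has_derivative blinfun_apply (g'' x)) (at x)) \<and>
       continuous_on S g'')"

definition jacobian_det :: "(real ^ 'n \<Rightarrow> real ^ 'n) \<Rightarrow> real ^ 'n \<Rightarrow> real"
  where "jacobian_det g x = det (matrix (frechet_derivative g (at x)))"

definition regular_value ::
  "(real ^ 'n \<Rightarrow> real ^ 'n) \<Rightarrow> (real ^ 'n) set \<Rightarrow> real ^ 'n \<Rightarrow> bool"
  where "regular_value g \<Omega> y \<longleftrightarrow> (\<forall>x\<in>\<Omega>. g x = y \<longrightarrow> jacobian_det g x \<noteq> 0)"

text \<open>The analytic definition of \<open>deg(f, \<Omega>, y)\<close>, for \<open>\<Omega>\<close> bounded and open, \<open>f\<close> continuous on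
  the closure of \<open>\<Omega>\<close> and \<open>y\<close> not in \<open>f(\<partial>\<Omega>)\<close>: approximate \<open>f\<close> to within the distance
  from \<open>y\<close> to \<open>f(\<partial>\<Omega>)\<close> by a map \<open>g\<close> which is \<open>C\<^sup>2\<close> in \<open>\<Omega>\<close>, continuous up to the boundary
  and has \<open>y\<close> as a regular value, and count the preimages of \<open>y\<close> under \<open>g\<close> with the signs
  of the Jacobian determinant. Since the boundary is compact, the condition quantified over
  all \<open>z\<close> below says that the error at each point is less than the distance from \<open>y\<close> to
  \<open>f(\<partial>\<Omega>)\<close>. The set of preimages is then finite, and the count is independent of \<open>g\<close>.
  If \<open>y\<close> lies in \<open>f(\<partial>\<Omega>)\<close> there is no such \<open>g\<close> and the value is unspecified.\<close>

definition brouwer_degree ::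
  "(real ^ 'n \<Rightarrow> real ^ 'n) \<Rightarrow> (real ^ 'n) set \<Rightarrow> real ^ 'n \<Rightarrow> int"
  where "brouwer_degree f \<Omega> y =
    (THE d. \<exists>g. continuous_on (closure \<Omega>) g \<and> C2_on g \<Omega> \<and>
       (\<forall>x\<in>closure \<Omega>. \<forall>z\<in>frontier \<Omega>. dist (g x) (f x) < dist y (f z)) \<and>
       regular_value g \<Omega> y \<and>
       of_int d = (\<Sum>x | x \<in> \<Omega> \<and> g x = y. sgn (jacobian_det g x)))"

definition sinh_gordon_degree ::
  "('v::finite \<times> 'v) set \<Rightarrow> ('v \<Rightarrow> 'v \<Rightarrow> real) \<Rightarrow> ('v \<Rightarrow> real) \<Rightarrow>
     ('v \<Rightarrow> real) \<Rightarrow> ('v \<Rightarrow> real) \<Rightarrow> real \<Rightarrow> int"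
  where "sinh_gordon_degree E \<omega> \<mu> hp hm c =
    Lim at_top (\<lambda>R. brouwer_degree (sinh_gordon_map E \<omega> \<mu> hp hm c) (Linf_ball R) 0)"

end

theory Submission imports Defs begin

text \<open>The degree is homotopy invariant because the signed count of zeros is an integral:
  composing with a clamp in each coordinate, a map \<open>g\<close> with regular value \<open>0\<close> becomes a map
  whose Jacobian determinant is a bump around \<open>0\<close> pulled back along \<open>g\<close>, and its integral
  is the signed count times the integral of the bump. The integral of a Jacobian determinant does
  not change when the map is modified on a compact set, since
  \<open>\<integral> det Dw = 0\<close> for compactly supported \<open>w\<close>; so two maps joined by a segment
  without zeros near the boundary have equal counts, as one can be cut off into the other.

  The sinh-Gordon map is joined by a segment to the decoupled map
  \<open>u \<mapsto> - \<sigma>\<^sub>+ e\<^sup>u - \<sigma>\<^sub>- e\<^sup>-\<^sup>u\<close>, where \<open>\<sigma>\<^sub>+ = 1\<close> on \<open>{h\<^sub>+ > 0}\<close>, \<open>\<sigma>\<^sub>- = -1\<close> on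
  \<open>{h\<^sub>- < 0}\<close>, and \<open>\<sigma>\<^sub>+ = -1\<close>, \<open>\<sigma>\<^sub>- = 1\<close> on the respective complements. The zeros along the segment are
  bounded: if \<open>M = max |u|\<close> is attained where \<open>u\<close> is positive, the equation keeps \<open>u\<close> within
  a constant of \<open>M\<close> on passing to neighbours until a vertex with \<open>h\<^sub>+ \<noteq> 0\<close> is reached, and there the
  exponential beats the Laplacian, which is at most linear in \<open>M\<close>. The decoupled map has a zero
  only if the two sets coincide, and then only \<open>u = 0\<close>, with diagonal Jacobian.\<close>

section \<open>Differentiable cutoff functions\<close>

text \<open>A C^1, piecewise quadratic primitive of the positive part; its second differences supply
  all cutoffs.\<close>

definition pos_half_square :: "real \<Rightarrow> real"
  where "pos_half_square s = (max 0 s)\<^sup>2 / 2"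

lemma pos_half_square_deriv:
  "(pos_half_square has_real_derivative max 0 s) (at s)"
proof -
  consider "s < 0" | "s = 0" | "s > 0" by linarith
  then show ?thesis
  proof cases
    case 1
    have "((\<lambda>_. 0) has_real_derivative max 0 s) (at s)"
      using 1 by simp
    then show ?thesis
      by (rule has_field_derivative_transform_within_open[where S="{..<0}"])
        (use 1 in \<open>auto simp: pos_half_square_def\<close>)
  next
    case 2
    have "((\<lambda>h. (pos_half_square (0 + h) - pos_half_square 0) / h) \<longlongrightarrow> 0) (at 0)"
    proof (rule Lim_null_comparison)
      show "\<forall>\<^sub>F h in at 0. norm ((pos_half_square (0 + h) - pos_half_square 0) / h) \<le> \<bar>h\<bar>"
        by (intro always_eventually) (auto simp: pos_half_square_def max_def power2_eq_square)
      show "((\<lambda>h. \<bar>h::real\<bar>) \<longlongrightarrow> 0) (at 0)"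
        using tendsto_rabs[OF tendsto_ident_at, of 0 UNIV] by simp
    qed
    then show ?thesis
      using 2 by (simp add: DERIV_def)
  next
    case 3
    have "((\<lambda>s. s\<^sup>2 / 2) has_real_derivative max 0 s) (at s)"
      using 3 by (auto intro!: derivative_eq_intros)
    then show ?thesis
      by (rule has_field_derivative_transform_within_open[where S="{0<..}"])
        (use 3 in \<open>auto simp: pos_half_square_def\<close>)
  qed
qed

text \<open>For \<open>e \<ge> 0\<close> the tent on \<open>[-e, e]\<close> with peak
  \<open>e\<close> at 0.\<close>

definition hat :: "real \<Rightarrow> real \<Rightarrow> real"
  where "hat e s = max 0 (s + e) - 2 * max 0 s + max 0 (s - e)"

text \<open>Rises from 0 left of \<open>- e\<close> to \<open>e\<^sup>2\<close> right of
  \<open>e\<close>. Rescaled it is the step behind the cutoffs; applied coordinatewise it is the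
  clamp that localizes Jacobian determinants.\<close>

definition hat_primitive :: "real \<Rightarrow> real \<Rightarrow> real"
  where "hat_primitive e s =
    pos_half_square (s + e) - 2 * pos_half_square s + pos_half_square (s - e)"

lemma hat_primitive_deriv: "(hat_primitive e has_real_derivative hat e s) (at s)"
proof -
  have "((\<lambda>s. pos_half_square (s + c)) has_real_derivative max 0 (s + c)) (at s)" for c
    using pos_half_square_deriv[of "s + c"] by (simp add: DERIV_shift)
  from this[of e] this[of 0] this[of "-e"] show ?thesis
    unfolding hat_primitive_def[abs_def] hat_def
    by (auto intro!: derivative_eq_intros)
qed

lemma continuous_on_hat [continuous_intros]:
  "continuous_on S f \<Longrightarrow> continuous_on S (\<lambda>x. hat e (f x))"
  unfolding hat_def by (intro continuous_intros)

lemma hat_nonneg: "e \<ge> 0 \<Longrightarrow> hat e s \<ge> 0"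
  by (auto simp: hat_def max_def)

lemma hat_eq_0: "e \<ge> 0 \<Longrightarrow> \<bar>s\<bar> \<ge> e \<Longrightarrow> hat e s = 0"
  by (auto simp: hat_def max_def)

lemma hat_at_0: "e \<ge> 0 \<Longrightarrow> hat e 0 = e"
  by (auto simp: hat_def max_def)

lemma hat_primitive_eq_0: "e \<ge> 0 \<Longrightarrow> s \<le> - e \<Longrightarrow> hat_primitive e s = 0"
  by (simp add: hat_primitive_def pos_half_square_def max_absorb1)

lemma hat_primitive_eq_top: "e \<ge> 0 \<Longrightarrow> s \<ge> e \<Longrightarrow> hat_primitive e s = e\<^sup>2"
  by (auto simp: hat_primitive_def pos_half_square_def max_def power2_eq_square field_simps)

lemma hat_primitive_nonneg:
  assumes "e \<ge> 0" shows "hat_primitive e s \<ge> 0"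
proof (cases "s \<le> - e")
  case True
  then show ?thesis using hat_primitive_eq_0[OF assms] by simp
next
  case False
  have "hat_primitive e (- e) \<le> hat_primitive e s"
    by (rule DERIV_nonneg_imp_nondecreasing[of "- e" s])
      (use False hat_primitive_deriv hat_nonneg[OF assms] in \<open>auto intro!: exI\<close>)
  then show ?thesis using hat_primitive_eq_0[OF assms, of "- e"] by simp
qed

lemma hat_primitive_le:
  assumes "e \<ge> 0" shows "hat_primitive e s \<le> e\<^sup>2"
proof (cases "s \<ge> e")
  case True
  then show ?thesis using hat_primitive_eq_top[OF assms] by simp
next
  case False
  have "hat_primitive e s \<le> hat_primitive e e"
    by (rule DERIV_nonneg_imp_nondecreasing[of s e])
      (use False hat_primitive_deriv hat_nonneg[OF assms] in \<open>auto intro!: exI\<close>)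
  then show ?thesis using hat_primitive_eq_top[OF assms, of e] by simp
qed

text \<open>Finitely many balls cover \<open>K\<close> with doubled closed balls inside
  \<open>U\<close>. The sum of radial bumps on them is at least 1 on \<open>K\<close>, and a final
  step function truncates it to exactly 1 there, which also kills the gradient.\<close>

lemma C1_cutoff:
  fixes K U :: "'a::euclidean_space set"
  assumes K: "compact K" and U: "open U" and KU: "K \<subseteq> U"
  obtains \<phi> :: "'a \<Rightarrow> real" and \<phi>' :: "'a \<Rightarrow> 'a" and C
  where "\<And>x. (\<phi> has_derivative (\<lambda>v. \<phi>' x \<bullet> v)) (at x)" "continuous_on UNIV \<phi>'"
    "compact C" "C \<subseteq> U" "K \<subseteq> interior C"
    "\<And>x. x \<in> K \<Longrightarrow> \<phi> x = 1" "\<And>x. x \<in> K \<Longrightarrow> \<phi>' x = 0"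
    "\<And>x. x \<notin> C \<Longrightarrow> \<phi> x = 0" "\<And>x. x \<notin> C \<Longrightarrow> \<phi>' x = 0"
    "\<And>x. 0 \<le> \<phi> x" "\<And>x. \<phi> x \<le> 1"
proof -
  \<comment> \<open>The tent of half-width 1/2 has mass 1/4, hence the factor 4; the shift places
    the rise on \<open>[0, 1]\<close>.\<close>
  define step where "step s = 4 * hat_primitive (1/2) (s - 1/2)" for s
  define step' where "step' s = 4 * hat (1/2) (s - 1/2)" for s
  have step_deriv: "(step has_real_derivative step' s) (at s)" for s
    using hat_primitive_deriv[of "1/2" "s + - (1/2)"]
    unfolding step_def[abs_def] step'_def DERIV_shift
    by (auto intro!: derivative_eq_intros)
  have step_0: "step s = 0" "step' s = 0" if "s \<le> 0" for s
    using that hat_primitive_eq_0[of "1/2" "s - 1/2"] hat_eq_0[of "1/2" "s - 1/2"]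
    by (auto simp: step_def step'_def)
  have step_1: "step s = 1" "step' s = 0" if "s \<ge> 1" for s
    using that hat_primitive_eq_top[of "1/2" "s - 1/2"] hat_eq_0[of "1/2" "s - 1/2"]
    by (auto simp: step_def step'_def power2_eq_square)
  have step_nonneg: "step s \<ge> 0" for s
    by (simp add: step_def hat_primitive_nonneg)
  have step_le: "step s \<le> 1" for s
    using hat_primitive_le[of "1/2" "s - 1/2"] by (simp add: step_def power2_eq_square)
  have step'_cont: "continuous_on S (\<lambda>x. step' (f x))" if "continuous_on S f"
    for f and S :: "'a set"
    unfolding step'_def using that by (intro continuous_intros)
  have step_cont: "continuous_on S (\<lambda>x. step (f x))" if "continuous_on S f"
    for f and S :: "'a set"
    using continuous_on_compose2[OF _ that, of UNIV step] step_deriv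
    by (meson DERIV_isCont continuous_at_imp_continuous_on subset_UNIV)
  have "\<exists>r. \<forall>x\<in>K. r x > 0 \<and> cball x (2 * r x) \<subseteq> U"
  proof (rule bchoice, intro ballI)
    fix x assume "x \<in> K"
    then obtain e where "e > 0" "cball x e \<subseteq> U"
      using U KU open_contains_cball by blast
    then show "\<exists>r>0. cball x (2 * r) \<subseteq> U"
      by (intro exI[of _ "e/2"]) auto
  qed
  then obtain r where r: "\<And>x. x \<in> K \<Longrightarrow> r x > 0" "\<And>x. x \<in> K \<Longrightarrow> cball x (2 * r x) \<subseteq> U"
    by blast
  obtain D where D: "D \<subseteq> K" "finite D" "K \<subseteq> (\<Union>x\<in>D. ball x (r x))"
    by (rule compactE_image[OF K, of K "\<lambda>x. ball x (r x)"]) (use r in auto)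
  \<comment> \<open>The argument of \<open>step\<close> is at least 1 within distance
    \<open>r x\<close> of \<open>x\<close> and at most 0 beyond \<open>2 * r x\<close>; the squared
    distance keeps it differentiable at the centre.\<close>
  define b where "b x y = step (2 - (y - x) \<bullet> (y - x) / (r x)\<^sup>2)" for x y
  define b' where "b' x y = (- 2 * step' (2 - (y - x) \<bullet> (y - x) / (r x)\<^sup>2) / (r x)\<^sup>2) *\<^sub>R (y - x)"
    for x y
  define s where "s y = (\<Sum>x\<in>D. b x y)" for y
  define C where "C = (\<Union>x\<in>D. cball x (2 * r x))"
  have b_deriv: "(b x has_derivative (\<lambda>v. b' x y \<bullet> v)) (at y)" for x y
  proof -
    have "((\<lambda>y. 2 - (y - x) \<bullet> (y - x) * inverse ((r x)\<^sup>2)) has_derivative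
        (\<lambda>v. - 2 * ((y - x) \<bullet> v) * inverse ((r x)\<^sup>2))) (at y)"
      by (auto intro!: derivative_eq_intros simp: inner_commute)
    then have "((\<lambda>y. 2 - (y - x) \<bullet> (y - x) / (r x)\<^sup>2) has_derivative
        (\<lambda>v. - 2 * ((y - x) \<bullet> v) / (r x)\<^sup>2)) (at y)"
      by (simp add: divide_inverse)
    from has_derivative_compose[OF this step_deriv[unfolded has_field_derivative_def]]
    show ?thesis
      unfolding b_def[abs_def] b'_def by (simp add: mult_ac)
  qed
  have b_out: "b x y = 0" "b' x y = 0" if "x \<in> D" "y \<notin> cball x (2 * r x)" for x y
  proof -
    have "2 * r x \<le> norm (y - x)" "r x > 0"
      using that D r by (auto simp: dist_norm norm_minus_commute)
    then have "(2 * r x)\<^sup>2 \<le> (y - x) \<bullet> (y - x)"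
      by (metis dot_square_norm mult_nonneg_nonneg less_imp_le power_mono zero_le_numeral)
    then have "4 * (r x)\<^sup>2 \<le> (y - x) \<bullet> (y - x)"
      by (simp add: power_mult_distrib)
    then have "2 * (r x)\<^sup>2 \<le> (y - x) \<bullet> (y - x)"
      using zero_le_power2[of "r x"] by linarith
    then have "2 - (y - x) \<bullet> (y - x) / (r x)\<^sup>2 \<le> 0"
      using \<open>r x > 0\<close> by (simp add: le_divide_eq)
    then show "b x y = 0" "b' x y = 0"
      using step_0 by (auto simp: b_def b'_def)
  qed
  have s_1: "s y \<ge> 1" if y: "y \<in> K" for y
  proof -
    obtain x where x: "x \<in> D" "y \<in> ball x (r x)" using D(3) y by blast
    then have rx: "r x > 0" "norm (y - x) \<le> r x"
      using D r by (auto simp: dist_norm norm_minus_commute)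
    then have "(y - x) \<bullet> (y - x) \<le> (r x)\<^sup>2"
      by (metis dot_square_norm norm_ge_zero power_mono)
    then have "2 - (y - x) \<bullet> (y - x) / (r x)\<^sup>2 \<ge> 1"
      using rx by (auto simp: field_simps)
    then have "b x y = 1" using step_1 by (auto simp: b_def)
    moreover have "b x y \<le> s y"
      unfolding s_def using D(2) x(1) step_nonneg
      by (intro member_le_sum) (auto simp: b_def)
    ultimately show ?thesis by simp
  qed
  have s_deriv: "(s has_derivative (\<lambda>v. (\<Sum>x\<in>D. b' x y) \<bullet> v)) (at y)" for y
    unfolding s_def[abs_def] inner_sum_left by (intro has_derivative_sum b_deriv)
  show ?thesis
  proof
    show "((\<lambda>y. step (s y)) has_derivative (\<lambda>v. (step' (s y) *\<^sub>R (\<Sum>x\<in>D. b' x y)) \<bullet> v)) (at y)" for y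
      using has_derivative_compose[OF s_deriv step_deriv[unfolded has_field_derivative_def]]
      by simp
    have "continuous_on UNIV s"
      using s_deriv by (meson continuous_at_imp_continuous_on has_derivative_continuous)
    then show "continuous_on UNIV (\<lambda>y. step' (s y) *\<^sub>R (\<Sum>x\<in>D. b' x y))"
      unfolding b'_def divide_inverse by (intro continuous_intros step'_cont)
    show "compact C" unfolding C_def using D by (intro compact_UN) auto
    show "C \<subseteq> U" unfolding C_def using D r by blast
    show "K \<subseteq> interior C"
    proof
      fix y assume "y \<in> K"
      then obtain x where x: "x \<in> D" "y \<in> ball x (r x)" using D(3) by blast
      then have "r x > 0" using D r by auto
      then have "ball x (r x) \<subseteq> C" unfolding C_def using x(1) by fastforce
      then show "y \<in> interior C" using x(2) by (meson interiorI open_ball)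
    qed
    show "0 \<le> step (s y)" "step (s y) \<le> 1" for y
      by (rule step_nonneg step_le)+
    show "step (s y) = 1" "step' (s y) *\<^sub>R (\<Sum>x\<in>D. b' x y) = 0" if "y \<in> K" for y
      using step_1 s_1[OF that] by auto
    show "step (s y) = 0" "step' (s y) *\<^sub>R (\<Sum>x\<in>D. b' x y) = 0" if "y \<notin> C" for y
    proof -
      have "s y = 0" using that b_out unfolding s_def C_def by (intro sum.neutral) auto
      then show "step (s y) = 0" "step' (s y) *\<^sub>R (\<Sum>x\<in>D. b' x y) = 0"
        using step_0 by auto
    qed
  qed
qed

section \<open>Integrals of Jacobian determinants\<close>

text \<open>The matrix is carried along explicitly, so that cutoffs, interpolations and reindexings
  can give theirs by formula.\<close>

definition has_jacobian_on ::
  "(real ^ 'n \<Rightarrow> real ^ 'n) \<Rightarrow> (real ^ 'n \<Rightarrow> real ^ 'n ^ 'n) \<Rightarrow> (real ^ 'n) set \<Rightarrow> bool"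
  where "has_jacobian_on f A S \<longleftrightarrow>
    (\<forall>x\<in>S. (f has_derivative (*v) (A x)) (at x)) \<and> continuous_on S A"

lemma has_jacobian_onD:
  assumes "has_jacobian_on f A S"
  shows "x \<in> S \<Longrightarrow> (f has_derivative (*v) (A x)) (at x)" "continuous_on S A"
  using assms by (auto simp: has_jacobian_on_def)

lemma has_jacobian_on_subset: "has_jacobian_on f A S \<Longrightarrow> T \<subseteq> S \<Longrightarrow> has_jacobian_on f A T"
  by (auto simp: has_jacobian_on_def intro: continuous_on_subset)

lemma has_jacobian_on_continuous: "has_jacobian_on f A S \<Longrightarrow> continuous_on S f"
  by (meson continuous_at_imp_continuous_on has_derivative_continuous has_jacobian_onD(1))

lemma continuous_on_matrix_components:
  fixes A :: "'a::topological_space \<Rightarrow> real ^ 'n ^ 'm"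
  assumes "\<And>i j. continuous_on S (\<lambda>x. A x $ i $ j)"
  shows "continuous_on S A"
proof -
  have "continuous_on S (\<lambda>x. \<chi> i j. A x $ i $ j)"
    by (intro continuous_on_vec_lambda assms)
  moreover have "(\<lambda>x. \<chi> i j. A x $ i $ j) = A" by (simp add: vec_eq_iff fun_eq_iff)
  ultimately show ?thesis by simp
qed

lemma continuous_on_det [continuous_intros]:
  fixes A :: "'a::topological_space \<Rightarrow> real ^ 'n ^ 'n"
  assumes "continuous_on S A"
  shows "continuous_on S (\<lambda>x. det (A x))"
  unfolding det_def by (intro continuous_intros assms)

lemma jacobian_unique:
  fixes A B :: "real ^ 'n ^ 'm"
  assumes "open S" "x \<in> S" "\<And>y. y \<in> S \<Longrightarrow> f y = g y"
    and "(f has_derivative (*v) A) (at x)" "(g has_derivative (*v) B) (at x)"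
  shows "A = B"
proof -
  have "(g has_derivative (*v) A) (at x)"
    using has_derivative_transform_within_open[OF assms(4,1,2)] assms(3) by blast
  then have "(*v) A = (*v) B"
    using assms(5) has_derivative_unique by blast
  then show ?thesis by (metis matrix_of_matrix_vector_mul)
qed

text \<open>Expanding each Leibniz product over the set \<open>X\<close> of rows that contribute an
  entry of \<open>t *\<^sub>R A\<close> sorts the determinant by powers of \<open>t\<close>; the top
  power takes every row from \<open>A\<close>.\<close>

lemma det_identity_plus_expansion:
  obtains c :: "nat \<Rightarrow> real ^ 'n ^ 'n \<Rightarrow> real"
  where "\<And>k. continuous_on UNIV (c k)" "c CARD('n) = det"
    "\<And>A t. det (mat 1 + t *\<^sub>R A) = (\<Sum>k\<le>CARD('n). c k A * t ^ k)"
proof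
  let ?P = "{p. p permutes (UNIV :: 'n set)}"
  define c :: "nat \<Rightarrow> real ^ 'n ^ 'n \<Rightarrow> real" where "c k A = (\<Sum>p\<in>?P. of_int (sign p) *
      (\<Sum>X | X \<in> Pow UNIV \<and> card X = k.
        (\<Prod>i\<in>X. A $ i $ p i) * (\<Prod>i\<in>UNIV - X. mat 1 $ i $ p i)))" for k A
  show "continuous_on UNIV (c k)" for k
    unfolding c_def by (intro continuous_intros)
  have "{X. X \<in> Pow UNIV \<and> card X = CARD('n)} = {UNIV :: 'n set}"
    using card_subset_eq[OF finite, of _ "UNIV :: 'n set"] by auto
  then show "c CARD('n) = det"
    unfolding c_def det_def fun_eq_iff by simp
  show "det (mat 1 + t *\<^sub>R A) = (\<Sum>k\<le>CARD('n). c k A * t ^ k)" for A t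
  proof -
    have "(\<Prod>i\<in>UNIV. (mat 1 + t *\<^sub>R A) $ i $ p i) = (\<Sum>k\<le>CARD('n).
        (\<Sum>X | X \<in> Pow UNIV \<and> card X = k.
          (\<Prod>i\<in>X. A $ i $ p i) * (\<Prod>i\<in>UNIV - X. mat 1 $ i $ p i)) * t ^ k)" for p :: "'n \<Rightarrow> 'n"
    proof -
      have "(\<Prod>i\<in>UNIV. (mat 1 + t *\<^sub>R A) $ i $ p i) =
          (\<Prod>i\<in>UNIV. t * A $ i $ p i + mat 1 $ i $ p i)"
        by (simp add: add.commute)
      also have "\<dots> = (\<Sum>X\<in>Pow UNIV.
          (\<Prod>i\<in>X. t * A $ i $ p i) * (\<Prod>i\<in>UNIV - X. mat 1 $ i $ p i))"
        by (rule prod_add) simp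
      also have "\<dots> = (\<Sum>k\<le>CARD('n). \<Sum>X | X \<in> Pow UNIV \<and> card X = k.
          (\<Prod>i\<in>X. t * A $ i $ p i) * (\<Prod>i\<in>UNIV - X. mat 1 $ i $ p i))"
        by (rule sum.group[symmetric]) (auto intro: card_mono)
      also have "\<dots> = (\<Sum>k\<le>CARD('n). (\<Sum>X | X \<in> Pow UNIV \<and> card X = k.
          (\<Prod>i\<in>X. A $ i $ p i) * (\<Prod>i\<in>UNIV - X. mat 1 $ i $ p i)) * t ^ k)"
        unfolding sum_distrib_right
        by (intro sum.cong refl) (auto simp: prod.distrib)
      finally show ?thesis .
    qed
    then have "det (mat 1 + t *\<^sub>R A) = (\<Sum>p\<in>?P. of_int (sign p) * (\<Sum>k\<le>CARD('n).
        (\<Sum>X | X \<in> Pow UNIV \<and> card X = k.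
          (\<Prod>i\<in>X. A $ i $ p i) * (\<Prod>i\<in>UNIV - X. mat 1 $ i $ p i)) * t ^ k))"
      unfolding det_def by simp
    also have "\<dots> = (\<Sum>k\<le>CARD('n). c k A * t ^ k)"
      unfolding c_def sum_distrib_left sum_distrib_right
      by (subst sum.swap) (simp only: mult.assoc)
    finally show ?thesis .
  qed
qed

lemma compact_norm_bounded_below:
  fixes f :: "'a::topological_space \<Rightarrow> 'b::real_normed_vector"
  assumes S: "compact S" "continuous_on S f" and nz: "\<And>x. x \<in> S \<Longrightarrow> f x \<noteq> 0"
  obtains e where "e > 0" "\<And>x. x \<in> S \<Longrightarrow> e \<le> norm (f x)"
proof (cases "S = {}")
  case True
  then show ?thesis using that[of 1] by simp
next
  case False
  then obtain m where "m \<in> S" "\<And>x. x \<in> S \<Longrightarrow> norm (f m) \<le> norm (f x)"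
    using continuous_attains_inf[OF S(1) False continuous_on_norm[OF S(2)]] by blast
  then show ?thesis using that[of "norm (f m)"] nz by simp
qed

lemma absolutely_integrable_on_compact:
  fixes f :: "'a::euclidean_space \<Rightarrow> 'b::euclidean_space"
  assumes "compact S" "continuous_on S f"
  shows "f absolutely_integrable_on S"
  using borel_integrable_compact[OF assms] unfolding set_integrable_def
  by (subst integrable_completion) auto

lemma integrable_on_compact:
  fixes f :: "'a::euclidean_space \<Rightarrow> 'b::euclidean_space"
  assumes "compact S" "continuous_on S f"
  shows "f integrable_on S"
  using absolutely_integrable_on_compact[OF assms] by (rule set_lebesgue_integral_eq_integral(1))

text \<open>For small \<open>t\<close> the map \<open>x + t w(x)\<close> is a diffeomorphism of the ball, so the integral of its
  Jacobian determinant, a polynomial in \<open>t\<close>, is constant; the leading coefficient is the integral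
  in question.\<close>

lemma integral_det_jacobian_compact_support:
  fixes w :: "real ^ 'n::{finite,wellorder} \<Rightarrow> real ^ 'n::_"
  assumes jac: "has_jacobian_on w A UNIV"
    and supp: "\<And>x. x \<notin> cball 0 r \<Longrightarrow> w x = 0"
  shows "integral (cball 0 r) (\<lambda>x. det (A x)) = 0"
proof -
  let ?B = "cball (0 :: real ^ 'n::_) r"
  have wA: "(w has_derivative (*v) (A x)) (at x)" for x
    using jac has_jacobian_onD by blast
  have contA: "continuous_on S A" for S
    using has_jacobian_onD(2)[OF jac] continuous_on_subset by blast
  have A0: "A x = 0" if "x \<notin> ?B" for x
    by (rule jacobian_unique[of "- ?B" x w "\<lambda>_. 0", OF _ _ _ wA])
      (use that supp in \<open>auto intro!: derivative_eq_intros\<close>)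
  \<comment> \<open>The sum of the absolute entries dominates the operator norm, so its bound
    \<open>L\<close> is a Lipschitz constant of \<open>w\<close>.\<close>
  define N where "N x = (\<Sum>i\<in>UNIV. \<Sum>j\<in>UNIV. \<bar>A x $ i $ j\<bar>)" for x
  have "compact (N ` ?B)"
    unfolding N_def by (intro compact_continuous_image continuous_intros contA) auto
  then obtain L0 where L0: "\<And>x. x \<in> ?B \<Longrightarrow> N x \<le> L0"
    using compact_imp_bounded bounded_has_Sup(1) by (metis (no_types) bdd_above_def bounded_imp_bdd_above imageI)
  define L where "L = max 1 L0"
  have L: "L > 0" "N x \<le> L" for x
  proof -
    show "L > 0" by (simp add: L_def)
    show "N x \<le> L"
      using L0[of x] A0[of x] by (cases "x \<in> ?B") (auto simp: L_def N_def)
  qed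
  have onormA: "onorm ((*v) (A x)) \<le> L" for x
    using onorm_le_matrix_component_sum[of "A x"] L(2)[of x] by (simp add: N_def)
  have lip: "norm (w x - w y) \<le> L * norm (x - y)" for x y
    by (rule differentiable_bound[of UNIV w "\<lambda>x. (*v) (A x)"]) (use wA onormA in auto)
  \<comment> \<open>Here \<open>t *\<^sub>R w\<close> is a contraction, so \<open>f\<close> is
    bijective by Banach's fixed point theorem; being the identity off the ball, it maps the ball
    onto itself, and change of variables returns the volume.\<close>
  have vol: "((\<lambda>x. det (mat 1 + t *\<^sub>R A x)) has_integral measure lebesgue ?B) ?B"
    if t: "0 \<le> t" "t < 1 / L" for t
  proof -
    define f where "f x = x + t *\<^sub>R w x" for x
    have tL: "0 \<le> t * L" "t * L < 1" using t L by (auto simp: field_simps)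
    have tlip: "norm (t *\<^sub>R w x - t *\<^sub>R w y) \<le> (t * L) * norm (x - y)" for x y
      using mult_left_mono[OF lip[of x y] t(1)] t(1)
      by (simp add: mult.assoc flip: scaleR_diff_right)
    have inj: "inj f"
    proof (rule injI)
      fix x y assume "f x = f y"
      then have "x - y = t *\<^sub>R w y - t *\<^sub>R w x" by (simp add: f_def algebra_simps)
      then have "norm (x - y) \<le> (t * L) * norm (x - y)"
        using tlip[of y x] by (simp add: norm_minus_commute)
      then show "x = y" using tL by (cases "x = y") auto
    qed
    have surj: "\<exists>x. f x = y" for y
    proof -
      have "\<exists>!x\<in>UNIV. y - t *\<^sub>R w x = x"
        by (rule Banach_fix[OF complete_UNIV _ tL])
          (use tlip in \<open>auto simp: dist_norm norm_minus_commute\<close>)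
      then show ?thesis unfolding f_def by (metis diff_add_cancel)
    qed
    have out: "f x = x" if "x \<notin> ?B" for x using supp[OF that] by (simp add: f_def)
    have img: "f ` ?B = ?B"
    proof
      show "f ` ?B \<subseteq> ?B" using out inj by (metis (no_types, lifting) image_subsetI injD)
      show "?B \<subseteq> f ` ?B" using out surj by (metis image_eqI subsetI)
    qed
    have fA: "(f has_derivative (*v) (mat 1 + t *\<^sub>R A x)) (at x)" for x
      unfolding f_def matrix_vector_mult_add_rdistrib[abs_def]
      by (auto intro!: derivative_eq_intros wA simp: scaleR_matrix_vector_assoc)
    \<comment> \<open>The determinant is 1 at \<open>s = 0\<close> and cannot vanish on
      \<open>[0, t]\<close>, since \<open>s *\<^sub>R A x\<close> has norm below 1; so it stays
      positive.\<close>
    have pos: "det (mat 1 + t *\<^sub>R A x) > 0" for x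
    proof -
      have nz: "det (mat 1 + s *\<^sub>R A x) \<noteq> 0" if s: "0 \<le> s" "s \<le> t" for s
      proof -
        have "v = 0" if "(mat 1 + s *\<^sub>R A x) *v v = 0" for v
        proof -
          have "v = - (s *\<^sub>R (A x *v v))"
            using that by (simp add: matrix_vector_mult_add_rdistrib scaleR_matrix_vector_assoc
                eq_neg_iff_add_eq_0)
          then have "norm v = s * norm (A x *v v)"
            using s by (metis abs_of_nonneg norm_minus_cancel norm_scaleR)
          also have "\<dots> \<le> t * (L * norm v)"
          proof (intro mult_mono s)
            show "norm (A x *v v) \<le> L * norm v"
              using onorm[OF matrix_vector_mul_bounded_linear[of "A x"], of v] onormA[of x]
              by (meson mult_right_mono norm_ge_zero order_trans)
          qed (use t in auto)
          finally show "v = 0" using tL by (cases "v = 0") auto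
        qed
        then show ?thesis
          by (metis invertible_det_nz invertible_left_inverse matrix_left_invertible_ker)
      qed
      have "continuous_on {0..t} (\<lambda>s. det (mat 1 + s *\<^sub>R A x))"
        by (intro continuous_intros)
      then show ?thesis
        using IVT2'[of "\<lambda>s. det (mat 1 + s *\<^sub>R A x)" t 0 0] nz t(1)
        by (force simp: not_less)
    qed
    have "((\<lambda>x. \<bar>det (matrix ((*v) (mat 1 + t *\<^sub>R A x)))\<bar>) has_integral measure lebesgue ?B) ?B"
    proof (subst has_measure_differentiable_image[symmetric, of _ f])
      show "?B \<in> sets lebesgue" by (simp add: fmeasurableD)
      show "inj_on f ?B" using inj inj_on_subset by blast
      show "f ` ?B \<in> lmeasurable \<and> measure lebesgue (f ` ?B) = measure lebesgue ?B"
        unfolding img by simp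
    qed (use fA has_derivative_at_withinI in blast)
    then show ?thesis using pos by (simp add: abs_of_pos del: matrix_vector_mult_add_rdistrib)
  qed
  obtain c where c: "\<And>k. continuous_on UNIV (c k)" "c CARD('n) = det"
    "\<And>(A :: real ^ 'n::_ ^ 'n::_) t. det (mat 1 + t *\<^sub>R A) = (\<Sum>k\<le>CARD('n). c k A * t ^ k)"
    using det_identity_plus_expansion by blast
  have int: "(\<lambda>x. c k (A x)) integrable_on ?B" for k
    by (intro integrable_on_compact compact_cball continuous_on_compose2[OF c(1) contA]) auto
  define m where "m = measure lebesgue ?B"
  \<comment> \<open>Coefficients of the polynomial in \<open>t\<close> that vanishes on
    \<open>[0, 1/L)\<close>; the volume \<open>m\<close> enters the constant term only.\<close>
  define d where "d k = integral ?B (\<lambda>x. c k (A x)) - (if k = 0 then m else 0)" for k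
  have "(\<Sum>k\<le>CARD('n). d k * t ^ k) = 0" if t: "t \<in> {0..<1/L}" for t
  proof -
    have "((\<lambda>x. \<Sum>k\<le>CARD('n). c k (A x) * t ^ k) has_integral
        (\<Sum>k\<le>CARD('n). integral ?B (\<lambda>x. c k (A x)) * t ^ k)) ?B"
      by (intro has_integral_sum has_integral_mult_left integrable_integral int) auto
    moreover have "((\<lambda>x. \<Sum>k\<le>CARD('n). c k (A x) * t ^ k) has_integral m) ?B"
      using vol[of t] t by (simp add: c(3) m_def)
    ultimately have "(\<Sum>k\<le>CARD('n). integral ?B (\<lambda>x. c k (A x)) * t ^ k) = m"
      using has_integral_unique by blast
    then show ?thesis
      by (simp add: d_def left_diff_distrib sum_subtractf if_distrib[of "\<lambda>x. x * _"] cong: if_cong)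
  qed
  then have "{0..<1/L} \<subseteq> {t. (\<Sum>k\<le>CARD('n). d k * t ^ k) = 0}" by blast
  moreover have "infinite {0..<1/L}" using L by (simp add: infinite_Ico)
  ultimately have "\<not> (\<exists>k\<le>CARD('n). d k \<noteq> 0)"
    using polyfun_finite_roots[of d "CARD('n)"] infinite_super by blast
  \<comment> \<open>As \<open>CARD('n)\<close> is positive, the top coefficient has no correction by
    \<open>m\<close> and is the integral of \<open>det (A x)\<close>.\<close>
  then have "d CARD('n) = 0" by blast
  then show ?thesis by (simp add: d_def c(2))
qed

section \<open>Cutting off maps and localizing the integral of the determinant\<close>

text \<open>On \<Omega> this is the product rule, with a rank-one term from the gradient of \<phi>;
  on the open complement of \<open>C\<close> everything is zero. These two open sets cover the
  space.\<close>

lemma has_jacobian_on_cutoff: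
  assumes w: "has_jacobian_on w A \<Omega>" and \<Omega>: "open \<Omega>"
    and \<phi>: "\<And>x. (\<phi> has_derivative (\<lambda>v. \<phi>' x \<bullet> v)) (at x)" "continuous_on UNIV \<phi>'"
    and C: "closed C" "C \<subseteq> \<Omega>" "\<And>x. x \<notin> C \<Longrightarrow> \<phi> x = 0" "\<And>x. x \<notin> C \<Longrightarrow> \<phi>' x = 0"
  shows "has_jacobian_on (\<lambda>x. \<phi> x *\<^sub>R w x)
    (\<lambda>x. \<phi> x *\<^sub>R A x + (\<chi> i j. w x $ i * \<phi>' x $ j)) UNIV" (is "has_jacobian_on _ ?B _")
proof -
  have deriv: "((\<lambda>x. \<phi> x *\<^sub>R w x) has_derivative (*v) (?B x)) (at x)" for x
  proof (cases "x \<in> \<Omega>")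
    case True
    have "((\<lambda>x. \<phi> x *\<^sub>R w x) has_derivative
        (\<lambda>v. \<phi> x *\<^sub>R (A x *v v) + (\<phi>' x \<bullet> v) *\<^sub>R w x)) (at x)"
      by (rule has_derivative_scaleR[OF \<phi>(1) has_jacobian_onD(1)[OF w True]])
    moreover have "\<phi> x *\<^sub>R (A x *v v) + (\<phi>' x \<bullet> v) *\<^sub>R w x = ?B x *v v" for v
      by (simp add: vec_eq_iff matrix_vector_mult_def inner_vec_def sum_distrib_left
          sum_distrib_right algebra_simps flip: sum.distrib)
    ultimately show ?thesis by simp
  next
    case False
    then have x: "x \<in> - C" using C by blast
    have "((\<lambda>_. 0) has_derivative (*v) (?B x)) (at x)"
    proof -
      have "?B x = 0" using x C by (simp add: vec_eq_iff)
      then have "(*v) (?B x) = (\<lambda>_. 0)" by (simp add: fun_eq_iff)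
      then show ?thesis by simp
    qed
    then show ?thesis
      by (rule has_derivative_transform_within_open[OF _ _ x])
        (use C in \<open>auto simp: open_closed\<close>)
  qed
  have "continuous_on \<Omega> ?B"
  proof (rule continuous_on_matrix_components)
    have "continuous_on \<Omega> \<phi>"
      using \<phi>(1) by (meson continuous_at_imp_continuous_on has_derivative_continuous)
    moreover have "continuous_on \<Omega> \<phi>'" using \<phi>(2) continuous_on_subset by blast
    ultimately show "continuous_on \<Omega> (\<lambda>x. ?B x $ i $ j)" for i j
      using has_jacobian_onD(2)[OF w] has_jacobian_on_continuous[OF w]
      by (simp add: continuous_intros)
  qed
  moreover have "continuous_on (- C) ?B"
    by (rule continuous_on_eq[of _ "\<lambda>_. 0"]) (use C in \<open>auto simp: vec_eq_iff\<close>)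
  moreover have \<Omega>C: "\<Omega> \<union> - C = UNIV" using C(2) by blast
  ultimately have "continuous_on (\<Omega> \<union> - C) ?B"
    using \<Omega> C by (intro continuous_on_open_Un) auto
  then show ?thesis
    using deriv \<Omega>C unfolding has_jacobian_on_def by simp
qed

text \<open>Cut both maps off with one \<phi> equal to 1 on \<open>K\<close>. Each cutoff has
  compact support, so its determinant integrates to 0 over a large ball; the two determinants agree
  off \<open>K\<close> and are the original ones on \<open>K\<close>.\<close>

lemma integral_det_jacobian_cong_off_compact:
  fixes w0 w1 :: "real ^ 'n::{finite,wellorder} \<Rightarrow> real ^ 'n::_"
  assumes \<Omega>: "open \<Omega>" and K: "compact K" "K \<subseteq> \<Omega>"
    and w0: "has_jacobian_on w0 A0 \<Omega>" and w1: "has_jacobian_on w1 A1 \<Omega>"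
    and eq: "\<And>x. x \<in> \<Omega> - K \<Longrightarrow> w0 x = w1 x"
  shows "integral K (\<lambda>x. det (A0 x)) = integral K (\<lambda>x. det (A1 x))"
proof -
  obtain \<phi> :: "real ^ 'n::_ \<Rightarrow> real" and \<phi>' C where \<phi>:
    "\<And>x. (\<phi> has_derivative (\<lambda>v. \<phi>' x \<bullet> v)) (at x)" "continuous_on UNIV \<phi>'"
    and C: "compact C" "C \<subseteq> \<Omega>" "K \<subseteq> interior C"
    and one: "\<And>x. x \<in> K \<Longrightarrow> \<phi> x = 1" "\<And>x. x \<in> K \<Longrightarrow> \<phi>' x = 0"
    and zero: "\<And>x. x \<notin> C \<Longrightarrow> \<phi> x = 0" "\<And>x. x \<notin> C \<Longrightarrow> \<phi>' x = 0"
    by (rule C1_cutoff[OF K(1) \<Omega> K(2)]) blast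
  define B where "B w A x = \<phi> x *\<^sub>R A x + (\<chi> i j. w x $ i * \<phi>' x $ j)"
    for w :: "real ^ 'n::_ \<Rightarrow> real ^ 'n::_" and A x
  obtain r where r: "C \<subseteq> cball 0 r"
    using compact_imp_bounded[OF C(1)] unfolding bounded_iff by (metis mem_cball_0 subsetI)
  have KB: "K \<subseteq> cball 0 r" using C(3) r interior_subset by blast
  have jac: "has_jacobian_on (\<lambda>x. \<phi> x *\<^sub>R w x) (B w A) UNIV" if "has_jacobian_on w A \<Omega>" for w A
    unfolding B_def
    by (rule has_jacobian_on_cutoff[OF that \<Omega> \<phi> compact_imp_closed[OF C(1)] C(2) zero])
  have int0: "integral (cball 0 r) (\<lambda>x. det (B w A x)) = 0" if "has_jacobian_on w A \<Omega>" for w A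
    by (rule integral_det_jacobian_compact_support[OF jac[OF that]]) (use r zero(1) in \<open>metis scaleR_eq_0_iff subsetD\<close>)
  have cont: "continuous_on S (\<lambda>x. det (B w A x))" if "has_jacobian_on w A \<Omega>" for w A S
    using has_jacobian_onD(2)[OF jac[OF that]]
    by (intro continuous_intros) (blast intro: continuous_on_subset)
  have zero_integral: "((\<lambda>x. det (B w0 A0 x) - det (B w1 A1 x)) has_integral 0) (cball 0 r)"
  proof -
    have "((\<lambda>x. det (B w0 A0 x) - det (B w1 A1 x)) has_integral integral (cball 0 r)
        (\<lambda>x. det (B w0 A0 x)) - integral (cball 0 r) (\<lambda>x. det (B w1 A1 x))) (cball 0 r)"
      by (intro has_integral_diff integrable_integral integrable_on_compact compact_cball cont w0 w1)
    then show ?thesis by (simp add: int0 w0 w1)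
  qed
  have "((\<lambda>x. det (B w0 A0 x) - det (B w1 A1 x)) has_integral
      (integral K (\<lambda>x. det (B w0 A0 x)) - integral K (\<lambda>x. det (B w1 A1 x)))) (cball 0 r)"
  proof (rule has_integral_on_superset[OF _ _ KB])
    show "((\<lambda>x. det (B w0 A0 x) - det (B w1 A1 x)) has_integral
        (integral K (\<lambda>x. det (B w0 A0 x)) - integral K (\<lambda>x. det (B w1 A1 x)))) K"
      by (intro has_integral_diff integrable_integral integrable_on_compact K cont w0 w1)
    show "det (B w0 A0 x) - det (B w1 A1 x) = 0" if "x \<notin> K" for x
    proof (cases "x \<in> \<Omega>")
      case True
      have "A0 x = A1 x"
        by (rule jacobian_unique[of "\<Omega> - K" x w0 w1])
          (use True that eq \<Omega> K has_jacobian_onD(1)[OF w0] has_jacobian_onD(1)[OF w1]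
            in \<open>auto intro: open_Diff compact_imp_closed\<close>)
      then show ?thesis using eq[of x] True that by (simp add: B_def)
    next
      case False
      then have "x \<notin> C" using C(2) by blast
      then show ?thesis using zero[of x] by (simp add: B_def)
    qed
  qed
  from has_integral_unique[OF this zero_integral]
  have "integral K (\<lambda>x. det (B w0 A0 x)) = integral K (\<lambda>x. det (B w1 A1 x))" by simp
  moreover have "B w A x = A x" if "x \<in> K" for w A x
    using one[OF that] by (simp add: B_def vec_eq_iff)
  ultimately show ?thesis by (simp cong: integral_cong)
qed

section \<open>Signed counts of zeros as integrals\<close>

text \<open>The inverse function theorem, applied inside the open set where the determinant keeps
  the sign it has at \<open>z\<close>.\<close>

lemma jacobian_local_diffeomorphism:
  fixes g :: "real ^ 'n \<Rightarrow> real ^ 'n"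
  assumes jac: "has_jacobian_on g A \<Omega>" and \<Omega>: "open \<Omega>" and z: "z \<in> \<Omega>" "det (A z) \<noteq> 0"
  shows "\<exists>U h h'. open U \<and> z \<in> U \<and> U \<subseteq> \<Omega> \<and> (\<forall>x\<in>U. h (g x) = x \<and>
      sgn (det (A x)) = sgn (det (A z)) \<and> (h has_derivative h' (g x)) (at (g x)) \<and>
      h' (g x) \<circ> (*v) (A x) = id)"
proof -
  define U0 where "U0 = {x \<in> \<Omega>. det (A x) * det (A z) > 0}"
  have "open (\<Omega> \<inter> (\<lambda>x. det (A x) * det (A z)) -` {0<..})"
    by (intro continuous_open_preimage continuous_intros has_jacobian_onD(2)[OF jac] \<Omega>)
  then have U0: "open U0" by (simp add: U0_def vimage_def Int_def)
  have zU0: "z \<in> U0" using z by (auto simp: U0_def zero_less_mult_iff)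
  define g' where "g' x = Blinfun ((*v) (A x))" for x
  have g'_apply: "blinfun_apply (g' x) = (*v) (A x)" for x
    unfolding g'_def by (simp add: bounded_linear_Blinfun_apply)
  have cont: "continuous_on U0 g'"
  proof (rule continuous_on_blinfun_componentwise)
    fix i :: "real ^ 'n"
    have "continuous_on U0 A"
      using has_jacobian_onD(2)[OF jac] by (rule continuous_on_subset) (auto simp: U0_def)
    then have "continuous_on U0 (\<lambda>x. \<chi> k. \<Sum>j\<in>UNIV. A x $ k $ j * i $ j)"
      by (intro continuous_intros)
    then show "continuous_on U0 (\<lambda>x. blinfun_apply (g' x) i)"
      by (simp add: g'_apply matrix_vector_mult_def)
  qed
  obtain B where "B ** A z = mat 1"
    using z(2) invertible_det_nz invertible_left_inverse by blast
  then have inv: "Blinfun ((*v) B) o\<^sub>L g' z = id_blinfun"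
    by (intro blinfun_eqI)
      (simp add: bounded_linear_Blinfun_apply g'_apply matrix_vector_mul_assoc)
  have g_deriv: "(g has_derivative blinfun_apply (g' x)) (at x)" if "x \<in> U0" for x
    using that has_jacobian_onD(1)[OF jac] by (simp add: g'_apply U0_def)
  obtain U V h h' where U: "open U" "U \<subseteq> U0" "z \<in> U" and hom: "homeomorphism U V g h"
    and h: "\<And>y. y \<in> V \<Longrightarrow> (h has_derivative (h' y)) (at y)"
    and h': "\<And>y. y \<in> V \<Longrightarrow> h' y = Hilbert_Choice.inv (blinfun_apply (g' (h y)))"
      "\<And>y. y \<in> V \<Longrightarrow> bij (blinfun_apply (g' (h y)))"
    by (rule inverse_function_theorem[OF U0 g_deriv cont zU0 inv], assumption, rule that)
  show ?thesis
  proof (intro exI conjI ballI)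
    show "open U" "z \<in> U" "U \<subseteq> \<Omega>" using U by (auto simp: U0_def)
    fix x assume x: "x \<in> U"
    then have gx: "g x \<in> V" and hg: "h (g x) = x" using hom by (auto simp: homeomorphism_def)
    show "h (g x) = x" by (rule hg)
    show "sgn (det (A x)) = sgn (det (A z))"
      using U(2) x by (auto simp: U0_def sgn_if zero_less_mult_iff)
    show "(h has_derivative h' (g x)) (at (g x))" by (rule h[OF gx])
    show "h' (g x) \<circ> (*v) (A x) = id"
      using h'[OF gx] by (simp add: hg g'_apply bij_is_inj)
  qed
qed

text \<open>Regular zeros are isolated, hence finite in number by compactness. Near each, a change
  of variables yields \<open>I\<close> with the sign of the determinant; away from them
  \<open>g\<close> stays outside the support of \<phi>.\<close>

lemma integral_jacobian_regular_value:
  fixes g :: "real ^ 'n::{finite,wellorder} \<Rightarrow> real ^ 'n::_"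
  assumes jac: "has_jacobian_on g A \<Omega>" and \<Omega>: "open \<Omega>"
    and K: "compact K" "K \<subseteq> \<Omega>"
    and Z: "Z = {x \<in> \<Omega>. g x = 0}" "Z \<subseteq> interior K"
    and reg: "\<And>z. z \<in> Z \<Longrightarrow> det (A z) \<noteq> 0"
  obtains \<delta> where "\<delta> > 0"
    "\<And>\<phi> I. \<lbrakk>\<And>y. \<phi> y \<ge> 0; \<And>y. norm y \<ge> \<delta> \<Longrightarrow> \<phi> y = 0; (\<phi> has_integral I) UNIV\<rbrakk> \<Longrightarrow>
      ((\<lambda>x. \<phi> (g x) * det (A x)) has_integral (\<Sum>z\<in>Z. sgn (det (A z))) * I) K"
proof -
  have jacK: "has_jacobian_on g A (interior K)"
    using has_jacobian_on_subset[OF jac] K(2) interior_subset by blast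
  have contK: "continuous_on K g"
    using has_jacobian_on_continuous[OF jac] K(2) continuous_on_subset by blast
  define R where "R z U h h' \<longleftrightarrow> open U \<and> z \<in> U \<and> U \<subseteq> interior K \<and> (\<forall>x\<in>U. h (g x) = x \<and>
      sgn (det (A x)) = sgn (det (A z)) \<and> (h has_derivative h' (g x)) (at (g x)) \<and>
      h' (g x) \<circ> (*v) (A x) = id)" for z U h h'
  have "\<exists>U h h'. R z U h h'" if z: "z \<in> Z" for z
    unfolding R_def
    by (rule jacobian_local_diffeomorphism[OF jacK open_interior subsetD[OF Z(2) z] reg[OF z]])
  then obtain U h h' where R: "\<And>z. z \<in> Z \<Longrightarrow> R z (U z) (h z) (h' z)"
    by metis
  have U: "open (U z)" "z \<in> U z" "U z \<subseteq> interior K" if "z \<in> Z" for z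
    using R[OF that] by (auto simp: R_def)
  have h: "h z (g x) = x" and sg: "sgn (det (A x)) = sgn (det (A z))"
    and dh: "(h z has_derivative h' z (g x)) (at (g x))"
    and h': "h' z (g x) \<circ> (*v) (A x) = id" if "z \<in> Z" "x \<in> U z" for z x
    using R[OF that(1), unfolded R_def] that(2) by blast+
  have inj: "inj_on g (U z)" if "z \<in> Z" for z
    using h[OF that] by (metis inj_onI)
  have "Z = K \<inter> g -` {0}" using Z K(2) interior_subset by blast
  then have "closed Z"
    using continuous_closed_preimage[OF contK compact_imp_closed[OF K(1)], of "{0}"] by simp
  then have "compact (K \<inter> Z)" by (rule compact_Int_closed[OF K(1)])
  then have "compact Z" using \<open>Z = K \<inter> g -` {0}\<close> by (simp add: Int_absorb1)
  then obtain D where D: "D \<subseteq> Z" "finite D" "Z \<subseteq> (\<Union>z\<in>D. U z)"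
    by (rule compactE_image[of Z Z U]) (use U in auto)
  \<comment> \<open>\<open>g\<close> is injective on \<open>U d\<close>, so \<open>d\<close> is its
    only zero there: the finite subcover already contains every zero.\<close>
  have "Z \<subseteq> D"
  proof
    fix z assume z: "z \<in> Z"
    then obtain d where d: "d \<in> D" "z \<in> U d" using D by blast
    then have "z = d" using inj_onD[OF inj[of d], of z d] D z U Z(1) by auto
    then show "z \<in> D" using d by simp
  qed
  then have fin: "finite Z" using D finite_subset by blast
  have "\<forall>z\<in>Z. \<exists>d>0. \<forall>x\<in>Z. x \<noteq> z \<longrightarrow> d \<le> dist z x"
    using finite_set_avoid[OF fin] by blast
  then obtain d where d: "\<And>z. z \<in> Z \<Longrightarrow> d z > 0"
      "\<And>z x. z \<in> Z \<Longrightarrow> x \<in> Z \<Longrightarrow> x \<noteq> z \<Longrightarrow> d z \<le> dist z x"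
    by metis
  \<comment> \<open>A radius of at most half the distance to any other zero makes the neighbourhoods
    disjoint.\<close>
  define W where "W z = U z \<inter> ball z (d z / 2)" for z
  have W: "open (W z)" "z \<in> W z" "W z \<subseteq> U z" "W z \<subseteq> K" if "z \<in> Z" for z
    using U[OF that] d(1)[OF that] interior_subset[of K] by (auto simp: W_def)
  have disj: "W z \<inter> W z' = {}" if "z \<in> Z" "z' \<in> Z" "z \<noteq> z'" for z z'
  proof (rule ccontr)
    assume "W z \<inter> W z' \<noteq> {}"
    then obtain x where "dist z x < d z / 2" "dist z' x < d z' / 2" by (auto simp: W_def)
    moreover have "dist z z' \<le> dist z x + dist z' x" by (rule dist_triangle2)
    ultimately show False
      using d(2)[of z z'] d(2)[of z' z] that by (simp add: dist_commute)
  qed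
  have "\<forall>z\<in>Z. \<exists>e>0. ball 0 e \<subseteq> g ` W z"
  proof
    fix z assume z: "z \<in> Z"
    have "open (g ` W z)"
      by (rule invariance_of_domain)
        (use W[OF z] inj[OF z] contK in \<open>auto intro: continuous_on_subset inj_on_subset\<close>)
    moreover have "0 \<in> g ` W z" using z Z(1) W(2)[OF z] by force
    ultimately show "\<exists>e>0. ball 0 e \<subseteq> g ` W z" by (meson open_contains_ball)
  qed
  then obtain e where e: "\<And>z. z \<in> Z \<Longrightarrow> e z > 0" "\<And>z. z \<in> Z \<Longrightarrow> ball 0 (e z) \<subseteq> g ` W z"
    by metis
  define K' where "K' = K - (\<Union>z\<in>Z. W z)"
  have "compact K'" unfolding K'_def by (intro compact_diff K open_UN ballI W)
  moreover have "continuous_on K' g"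
    by (rule continuous_on_subset[OF contK]) (auto simp: K'_def)
  moreover have "g x \<noteq> 0" if "x \<in> K'" for x
    using that K(2) Z(1) W(2) by (auto simp: K'_def)
  ultimately obtain e0 where e0: "e0 > 0" "\<And>x. x \<in> K' \<Longrightarrow> e0 \<le> norm (g x)"
    using compact_norm_bounded_below[of K' g] by blast
  \<comment> \<open>At most \<open>e z\<close>, so the image of each \<open>W z\<close> covers the
    ball of radius \<delta>; at most \<open>e0\<close>, so nothing outside the \<open>W z\<close>
    contributes.\<close>
  define \<delta> where "\<delta> = Min (insert e0 (e ` Z))"
  have \<delta>: "\<delta> > 0" "\<delta> \<le> e0" "\<And>z. z \<in> Z \<Longrightarrow> \<delta> \<le> e z"
    using fin e0(1) e(1) by (auto simp: \<delta>_def)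
  show ?thesis
  proof
    show "\<delta> > 0" by fact
    fix \<phi> :: "real ^ 'n::_ \<Rightarrow> real" and I
    assume \<phi>: "\<And>y. \<phi> y \<ge> 0" "\<And>y. norm y \<ge> \<delta> \<Longrightarrow> \<phi> y = 0" "(\<phi> has_integral I) UNIV"
    let ?T = "ball (0 :: real ^ 'n::_) \<delta>"
    \<comment> \<open>Shrinking \<open>W z\<close> to the preimage of the ball makes
      \<open>g\<close> a bijection onto \<open>?T\<close>.\<close>
    define S where "S z = {x \<in> W z. g x \<in> ?T}" for z
    define F where "F x = (if x \<in> K then \<phi> (g x) * det (A x) else 0)" for x
    have \<phi>T: "(\<phi> has_integral I) ?T"
      by (subst has_integral_restrict_UNIV[symmetric], rule has_integral_eq[OF _ \<phi>(3)])
        (use \<phi>(2) in auto)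
    have FS: "(F has_integral sgn (det (A z)) * I) (S z)" if z: "z \<in> Z" for z
    proof -
      have hy: "h z y \<in> S z \<and> g (h z y) = y" if y: "y \<in> ?T" for y
      proof -
        have "y \<in> ball 0 (e z)" using y \<delta>(3)[OF z] by auto
        then obtain x where x: "x \<in> W z" "y = g x" using e(2)[OF z] by blast
        then show ?thesis using h[OF z, of x] W(3)[OF z] y by (auto simp: S_def)
      qed
      have SU: "x \<in> U z" if "x \<in> S z" for x using that W(3)[OF z] by (auto simp: S_def)
      have "((\<lambda>x. \<bar>det (matrix ((*v) (A x)))\<bar> * \<phi> (g x)) has_integral I) (S z)"
      proof (subst cov_invertible_nonneg_eq[where T = ?T and h = "h z" and h' = "h' z"])
        show "(g has_derivative (*v) (A x)) (at x within S z)" if "x \<in> S z" for x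
          using has_jacobian_onD(1)[OF jacK] SU[OF that] U(3)[OF z] has_derivative_at_withinI by blast
        show "(h z has_derivative h' z y) (at y within ?T)" if "y \<in> ?T" for y
          using dh[OF z SU] hy[OF that] has_derivative_at_withinI by metis
        show "h' z y \<circ> (*v) (A (h z y)) = id" if "y \<in> ?T" for y
          using h'[OF z SU] hy[OF that] by metis
        show "g x \<in> ?T \<and> h z (g x) = x" if "x \<in> S z" for x
          using that h[OF z SU[OF that]] by (auto simp: S_def)
      qed (use hy \<phi>(1) \<phi>T in auto)
      \<comment> \<open>The sign is constant on \<open>U z\<close>, so multiplying by it turns the
        absolute value of the determinant into the determinant itself.\<close>
      then have "((\<lambda>x. sgn (det (A z)) * (\<bar>det (A x)\<bar> * \<phi> (g x))) has_integral
          sgn (det (A z)) * I) (S z)"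
        by (intro has_integral_mult_right) simp
      moreover have "sgn (det (A z)) * (\<bar>det (A x)\<bar> * \<phi> (g x)) = F x" if "x \<in> S z" for x
      proof -
        have xK: "x \<in> K" using W(4)[OF z] that by (auto simp: S_def)
        have det_eq: "sgn (det (A z)) * \<bar>det (A x)\<bar> = det (A x)"
          using sg[OF z SU[OF that]] mult_sgn_abs[of "det (A x)"] by metis
        have "sgn (det (A z)) * (\<bar>det (A x)\<bar> * \<phi> (g x)) = det (A x) * \<phi> (g x)"
          unfolding mult.assoc[symmetric] det_eq ..
        then show ?thesis by (simp add: F_def xK mult.commute)
      qed
      ultimately show ?thesis by (rule has_integral_eq[rotated])
    qed
    have "(F has_integral (\<Sum>z\<in>Z. sgn (det (A z)) * I)) (\<Union>z\<in>Z. S z)"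
    proof (rule has_integral_UN[OF fin FS])
      have "S z \<inter> S z' = {}" if "z \<in> Z" "z' \<in> Z" "z \<noteq> z'" for z z'
        using disj[OF that] by (auto simp: S_def)
      then show "pairwise (\<lambda>z z'. negligible (S z \<inter> S z')) Z"
        by (simp add: pairwise_def)
    qed
    then have "(F has_integral (\<Sum>z\<in>Z. sgn (det (A z)) * I)) K"
    proof (rule has_integral_on_superset)
      show "(\<Union>z\<in>Z. S z) \<subseteq> K" using W(4) by (auto simp: S_def)
      show "F x = 0" if x: "x \<notin> (\<Union>z\<in>Z. S z)" for x
      proof (cases "x \<in> K \<and> norm (g x) < \<delta>")
        case True
        then have "x \<notin> (\<Union>z\<in>Z. W z)" using x by (auto simp: S_def)
        then have "x \<in> K'" using True by (auto simp: K'_def)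
        then show ?thesis using e0(2)[of x] \<delta>(2) True by simp
      qed (use \<phi>(2) in \<open>auto simp: F_def\<close>)
    qed
    then have "((\<lambda>x. \<phi> (g x) * det (A x)) has_integral (\<Sum>z\<in>Z. sgn (det (A z)) * I)) K"
      by (rule has_integral_eq[rotated]) (simp add: F_def)
    then show "((\<lambda>x. \<phi> (g x) * det (A x)) has_integral (\<Sum>z\<in>Z. sgn (det (A z))) * I) K"
      by (simp add: sum_distrib_right)
  qed
qed

section \<open>Homotopy invariance of the signed count of zeros\<close>

text \<open>The bump is continuous, nonnegative and positive at 0. That \<open>I\<close> is nonzero
  allows cancelling it from an equality of counts times \<open>I\<close>.\<close>

lemma has_integral_hat_bump:
  fixes e :: real
  assumes e: "e > 0"
  obtains I where "I \<noteq> 0" "((\<lambda>y :: real ^ 'n. \<Prod>i\<in>UNIV. hat e (y $ i)) has_integral I) UNIV"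
proof -
  define \<phi> where "\<phi> y = (\<Prod>i\<in>UNIV. hat e (y $ i))" for y :: "real ^ 'n"
  define a :: "real ^ 'n" where "a = (\<chi> i. - e)"
  define b :: "real ^ 'n" where "b = (\<chi> i. e)"
  have cont: "continuous_on S \<phi>" for S
    unfolding \<phi>_def by (intro continuous_intros)
  have int: "(\<phi> has_integral integral (cbox a b) \<phi>) (cbox a b)"
    by (intro integrable_integral integrable_continuous cont)
  have out: "\<phi> y = 0" if y: "y \<notin> cbox a b" for y
  proof -
    obtain i where "\<not> (- e \<le> y $ i \<and> y $ i \<le> e)"
      using y by (auto simp: mem_box_cart a_def b_def)
    then have "hat e (y $ i) = 0" using hat_eq_0[of e "y $ i"] e by auto
    then show ?thesis unfolding \<phi>_def by (intro prod_zero) auto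
  qed
  have "integral (cbox a b) \<phi> \<noteq> 0"
  proof
    assume "integral (cbox a b) \<phi> = 0"
    then have "\<phi> 0 = 0"
      using int e hat_nonneg[of e]
      by (intro has_integral_0_cbox_imp_0[of a b \<phi> 0] cont)
        (auto simp: mem_box_cart a_def b_def \<phi>_def prod_nonneg interval_ne_empty_cart)
    then show False using hat_at_0[of e] e by (simp add: \<phi>_def)
  qed
  moreover have "(\<phi> has_integral integral (cbox a b) \<phi>) UNIV"
    by (rule has_integral_on_superset[OF int out]) auto
  ultimately show ?thesis using that unfolding \<phi>_def by blast
qed

text \<open>The chain rule scales row \<open>i\<close> by \<open>hat e (g x $ i)\<close>, so the
  determinant of the clamped map is \<open>det (A x)\<close> times a product bump at
  \<open>g x\<close>.\<close>

lemma has_jacobian_on_hat_primitive: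
  fixes g :: "real ^ 'n \<Rightarrow> real ^ 'n"
  assumes g: "has_jacobian_on g A S"
  shows "has_jacobian_on (\<lambda>x. \<chi> i. hat_primitive e (g x $ i))
    (\<lambda>x. \<chi> i. hat e (g x $ i) *s A x $ i) S"
  unfolding has_jacobian_on_def
proof (intro conjI ballI)
  fix x assume x: "x \<in> S"
  have "((\<lambda>x. hat_primitive e (g x $ i)) has_derivative
      (\<lambda>v. hat e (g x $ i) * (A x *v v) $ i)) (at x)" for i
    using has_derivative_compose[OF
        bounded_linear.has_derivative[OF bounded_linear_vec_nth has_jacobian_onD(1)[OF g x]]
        hat_primitive_deriv[unfolded has_field_derivative_def]] .
  then show "((\<lambda>x. \<chi> i. hat_primitive e (g x $ i)) has_derivative
      (*v) (\<chi> i. hat e (g x $ i) *s A x $ i)) (at x)"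
    unfolding has_derivative_componentwise_within[where f = "\<lambda>x. \<chi> i. hat_primitive e (g x $ i)"]
    by (auto simp: Basis_vec_def inner_axis matrix_vector_mult_def sum_distrib_left mult.assoc)
next
  show "continuous_on S (\<lambda>x. \<chi> i. hat e (g x $ i) *s A x $ i)"
    using has_jacobian_onD(2)[OF g] has_jacobian_on_continuous[OF g]
    by (intro continuous_on_matrix_components) (simp add: continuous_intros)
qed

lemma has_jacobian_on_interpolate:
  fixes g0 g1 :: "real ^ 'n \<Rightarrow> real ^ 'n"
  assumes g0: "has_jacobian_on g0 A0 S" and g1: "has_jacobian_on g1 A1 S"
    and \<phi>: "\<And>x. (\<phi> has_derivative (\<lambda>v. \<phi>' x \<bullet> v)) (at x)" "continuous_on UNIV \<phi>'"
  shows "has_jacobian_on (\<lambda>x. g0 x + \<phi> x *\<^sub>R (g1 x - g0 x))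
    (\<lambda>x. A0 x + \<phi> x *\<^sub>R (A1 x - A0 x) + (\<chi> i j. (g1 x - g0 x) $ i * \<phi>' x $ j)) S"
    (is "has_jacobian_on _ ?B S")
  unfolding has_jacobian_on_def
proof (intro conjI ballI)
  fix x assume x: "x \<in> S"
  have "((\<lambda>x. g0 x + \<phi> x *\<^sub>R (g1 x - g0 x)) has_derivative
      (\<lambda>v. A0 x *v v + (\<phi> x *\<^sub>R (A1 x *v v - A0 x *v v) + (\<phi>' x \<bullet> v) *\<^sub>R (g1 x - g0 x)))) (at x)"
    by (intro has_derivative_add has_derivative_scaleR has_derivative_diff \<phi>(1)
        has_jacobian_onD(1)[OF g0 x] has_jacobian_onD(1)[OF g1 x])
  moreover have "A0 x *v v + (\<phi> x *\<^sub>R (A1 x *v v - A0 x *v v) + (\<phi>' x \<bullet> v) *\<^sub>R (g1 x - g0 x)) =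
      ?B x *v v" for v
    by (simp add: vec_eq_iff matrix_vector_mult_def inner_vec_def sum_distrib_left
        sum_distrib_right algebra_simps flip: sum.distrib sum_subtractf)
  ultimately show "((\<lambda>x. g0 x + \<phi> x *\<^sub>R (g1 x - g0 x)) has_derivative (*v) (?B x)) (at x)" by simp
next
  have "continuous_on S \<phi>"
    using \<phi>(1) by (meson continuous_at_imp_continuous_on has_derivative_continuous)
  moreover have "continuous_on S \<phi>'" using \<phi>(2) continuous_on_subset by blast
  ultimately show "continuous_on S ?B"
    using has_jacobian_onD(2)[OF g0] has_jacobian_on_continuous[OF g0]
      has_jacobian_onD(2)[OF g1] has_jacobian_on_continuous[OF g1]
    by (intro continuous_on_matrix_components) (simp add: continuous_intros)
qed

text \<open>\<open>G\<close> passes from \<open>g0\<close> off \<open>K\<close> to \<open>g1\<close>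
  on \<open>T\<close>. A zero \<open>x\<close> of \<open>G\<close> is a zero of the segment at
  parameter \<open>\<phi> x\<close>, so it lies in \<open>T\<close>, where \<open>G\<close> and its
  Jacobian are those of \<open>g1\<close>. The clamped \<open>g0\<close> and \<open>G\<close> agree
  off \<open>K\<close>, so the two integrals and hence the counts coincide.\<close>

lemma signed_count_homotopy_wellorder:
  fixes g0 g1 :: "real ^ 'n::{finite,wellorder} \<Rightarrow> real ^ 'n::_"
  assumes \<Omega>: "open \<Omega>" and T: "compact T" "T \<subseteq> \<Omega>"
    and g0: "has_jacobian_on g0 A0 \<Omega>" and g1: "has_jacobian_on g1 A1 \<Omega>"
    and zeros: "\<And>x t. \<lbrakk>x \<in> \<Omega>; 0 \<le> t; t \<le> 1; g0 x + t *\<^sub>R (g1 x - g0 x) = 0\<rbrakk> \<Longrightarrow> x \<in> T"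
    and reg0: "\<And>x. x \<in> \<Omega> \<Longrightarrow> g0 x = 0 \<Longrightarrow> det (A0 x) \<noteq> 0"
    and reg1: "\<And>x. x \<in> \<Omega> \<Longrightarrow> g1 x = 0 \<Longrightarrow> det (A1 x) \<noteq> 0"
  shows "(\<Sum>x | x \<in> \<Omega> \<and> g0 x = 0. sgn (det (A0 x))) = (\<Sum>x | x \<in> \<Omega> \<and> g1 x = 0. sgn (det (A1 x)))"
proof -
  obtain \<phi> :: "real ^ 'n::_ \<Rightarrow> real" and \<phi>' K where \<phi>:
    "\<And>x. (\<phi> has_derivative (\<lambda>v. \<phi>' x \<bullet> v)) (at x)" "continuous_on UNIV \<phi>'"
    and K: "compact K" "K \<subseteq> \<Omega>" "T \<subseteq> interior K"
    and one: "\<And>x. x \<in> T \<Longrightarrow> \<phi> x = 1" "\<And>x. x \<in> T \<Longrightarrow> \<phi>' x = 0"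
    and zero: "\<And>x. x \<notin> K \<Longrightarrow> \<phi> x = 0" "\<And>x. x \<notin> K \<Longrightarrow> \<phi>' x = 0"
    and \<phi>01: "\<And>x. 0 \<le> \<phi> x" "\<And>x. \<phi> x \<le> 1"
    by (rule C1_cutoff[OF T(1) \<Omega> T(2)]) blast
  define G where "G x = g0 x + \<phi> x *\<^sub>R (g1 x - g0 x)" for x
  define B where "B x = A0 x + \<phi> x *\<^sub>R (A1 x - A0 x) + (\<chi> i j. (g1 x - g0 x) $ i * \<phi>' x $ j)" for x
  have G: "has_jacobian_on G B \<Omega>"
    unfolding G_def[abs_def] B_def[abs_def] by (rule has_jacobian_on_interpolate[OF g0 g1 \<phi>])
  have GT: "G x = g1 x" "B x = A1 x" if "x \<in> T" for x
    using one[OF that] by (auto simp: G_def B_def vec_eq_iff)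
  have ZT: "x \<in> T" if "x \<in> \<Omega>" "g0 x = 0 \<or> g1 x = 0 \<or> G x = 0" for x
    using zeros[of x 0] zeros[of x 1] zeros[of x "\<phi> x"] that \<phi>01 by (auto simp: G_def)
  define Z0 where "Z0 = {x \<in> \<Omega>. g0 x = 0}"
  define Z1 where "Z1 = {x \<in> \<Omega>. G x = 0}"
  have Z1: "Z1 = {x. x \<in> \<Omega> \<and> g1 x = 0}"
    unfolding Z1_def using ZT GT(1) by (intro Collect_cong) metis
  have Z1T: "z \<in> T \<and> det (B z) \<noteq> 0" if "z \<in> Z1" for z
    using that ZT[of z] GT[of z] reg1[of z] by (simp add: Z1_def)
  obtain d0 where d0: "d0 > 0"
    "\<And>\<phi> I. \<lbrakk>\<And>y. \<phi> y \<ge> 0; \<And>y. norm y \<ge> d0 \<Longrightarrow> \<phi> y = 0; (\<phi> has_integral I) UNIV\<rbrakk> \<Longrightarrow>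
      ((\<lambda>x. \<phi> (g0 x) * det (A0 x)) has_integral (\<Sum>z\<in>Z0. sgn (det (A0 z))) * I) K"
    by (rule integral_jacobian_regular_value[OF g0 \<Omega> K(1,2) Z0_def])
      (use ZT K(3) reg0 in \<open>auto simp: Z0_def\<close>)
  obtain d1 where d1: "d1 > 0"
    "\<And>\<phi> I. \<lbrakk>\<And>y. \<phi> y \<ge> 0; \<And>y. norm y \<ge> d1 \<Longrightarrow> \<phi> y = 0; (\<phi> has_integral I) UNIV\<rbrakk> \<Longrightarrow>
      ((\<lambda>x. \<phi> (G x) * det (B x)) has_integral (\<Sum>z\<in>Z1. sgn (det (B z))) * I) K"
    by (rule integral_jacobian_regular_value[OF G \<Omega> K(1,2) Z1_def])
      (use Z1T K(3) in blast)+
  \<comment> \<open>If all coordinates are below \<open>e\<close> in absolute value, their l1 norm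
    is below \<open>min d0 d1\<close>; so the bump suits both integral formulas.\<close>
  define e where "e = min d0 d1 / CARD('n)"
  have e: "e > 0" using d0(1) d1(1) by (simp add: e_def)
  define \<psi> where "\<psi> y = (\<Prod>i\<in>UNIV. hat e (y $ i))" for y :: "real ^ 'n::_"
  obtain I where I: "I \<noteq> 0" "(\<psi> has_integral I) UNIV"
    unfolding \<psi>_def[abs_def] by (rule has_integral_hat_bump[OF e])
  have \<psi>_nonneg: "\<psi> y \<ge> 0" for y
    using hat_nonneg[of e] e by (auto simp: \<psi>_def intro!: prod_nonneg)
  have \<psi>_out: "\<psi> y = 0" if "norm y \<ge> min d0 d1" for y
  proof -
    have "\<exists>i. \<bar>y $ i\<bar> \<ge> e"
    proof (rule ccontr)
      assume "\<not> ?thesis"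
      then have "norm y < (\<Sum>i::'n\<in>UNIV. e)"
        by (intro le_less_trans[OF norm_le_l1_cart] sum_strict_mono) (auto simp: not_le)
      then show False using that by (auto simp: e_def min_le_iff_disj)
    qed
    then obtain i where "\<bar>y $ i\<bar> \<ge> e" by blast
    then have "hat e (y $ i) = 0" using hat_eq_0 e by simp
    then show ?thesis unfolding \<psi>_def by (intro prod_zero) auto
  qed
  have det_\<psi>: "det (\<chi> i. hat e (g x $ i) *s A x $ i) = \<psi> (g x) * det (A x)"
    for g :: "real ^ 'n::_ \<Rightarrow> real ^ 'n::_" and A :: "real ^ 'n::_ \<Rightarrow> (real ^ 'n::_) ^ 'n::_" and x
    using det_rows_mul[of "\<lambda>i. hat e (g x $ i)" "\<lambda>i. A x $ i"] by (simp add: \<psi>_def)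
  have "integral K (\<lambda>x. det (\<chi> i. hat e (g0 x $ i) *s A0 x $ i)) =
      integral K (\<lambda>x. det (\<chi> i. hat e (G x $ i) *s B x $ i))"
    by (rule integral_det_jacobian_cong_off_compact[OF \<Omega> K(1,2)
          has_jacobian_on_hat_primitive[OF g0] has_jacobian_on_hat_primitive[OF G]])
      (use zero in \<open>auto simp: G_def\<close>)
  then have "integral K (\<lambda>x. \<psi> (g0 x) * det (A0 x)) = integral K (\<lambda>x. \<psi> (G x) * det (B x))"
    by (simp only: det_\<psi>)
  moreover have "integral K (\<lambda>x. \<psi> (g0 x) * det (A0 x)) = (\<Sum>z\<in>Z0. sgn (det (A0 z))) * I"
    by (intro integral_unique d0(2) \<psi>_nonneg \<psi>_out I(2)) simp
  moreover have "integral K (\<lambda>x. \<psi> (G x) * det (B x)) = (\<Sum>z\<in>Z1. sgn (det (B z))) * I"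
    by (intro integral_unique d1(2) \<psi>_nonneg \<psi>_out I(2)) simp
  ultimately have "(\<Sum>z\<in>Z0. sgn (det (A0 z))) = (\<Sum>z\<in>Z1. sgn (det (B z)))"
    using I(1) by simp
  also have "\<dots> = (\<Sum>z\<in>Z1. sgn (det (A1 z)))"
    using GT ZT by (intro sum.cong) (auto simp: Z1_def)
  finally show ?thesis unfolding Z0_def Z1 .
qed

text \<open>Change of variables and Sard's theorem in HOL-Analysis require an index type of class
  \<open>wellorder\<close>. Every finite type has such a copy, along which they are transported.\<close>

typedef ('a::finite) index = "{..<CARD('a)}"
  by (rule exI[of _ 0]) simp

instance index :: (finite) finite
proof
  have "(UNIV :: 'a index set) = Abs_index ` {..<CARD('a)}"
    by (metis type_definition.Abs_image type_definition_index)
  then show "finite (UNIV :: 'a index set)" by (metis finite_imageI finite_lessThan)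
qed

instantiation index :: (finite) wellorder
begin

definition less_eq_index :: "'a index \<Rightarrow> 'a index \<Rightarrow> bool"
  where "less_eq_index i j \<longleftrightarrow> Rep_index i \<le> Rep_index j"

definition less_index :: "'a index \<Rightarrow> 'a index \<Rightarrow> bool"
  where "less_index i j \<longleftrightarrow> Rep_index i < Rep_index j"

instance
proof
  fix P :: "'a index \<Rightarrow> bool" and a :: "'a index"
  assume step: "\<And>i. (\<And>j. j < i \<Longrightarrow> P j) \<Longrightarrow> P i"
  show "P a"
  proof (induction a rule: measure_induct_rule[of Rep_index])
    case (less a)
    then show ?case using step less_index_def by blast
  qed
qed (auto simp: less_eq_index_def less_index_def Rep_index_inject)

end

lemma bij_index: obtains \<pi> :: "'a::finite index \<Rightarrow> 'a" where "bij \<pi>"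
proof -
  have "card (UNIV :: 'a index set) = CARD('a)"
    by (metis card_lessThan type_definition.card type_definition_index)
  then show ?thesis
    using that finite_same_card_bij[of "UNIV :: 'a index set" "UNIV :: 'a set"] by auto
qed

text \<open>Conjugation by \<pi> is a sign-preserving bijection between the permutations of the two
  index types and matches the Leibniz terms one by one.\<close>

lemma det_reindex:
  fixes A :: "'a::comm_ring_1 ^ 'n ^ 'n" and \<pi> :: "'m::finite \<Rightarrow> 'n"
  assumes "bij \<pi>"
  shows "det (\<chi> i j. A $ \<pi> i $ \<pi> j) = det A"
proof -
  let ?q = "\<lambda>p. \<pi> \<circ> p \<circ> inv \<pi>"
  have inj: "inj \<pi>" and surj: "surj \<pi>" using assms by (auto simp: bij_def)
  have mp: "map_permutation UNIV \<pi> p = ?q p" for p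
    using surj by (simp add: map_permutation_def restrict_id_def fun_eq_iff)
  show ?thesis
    unfolding det_def
  proof (rule sum.reindex_bij_witness[of _ "\<lambda>q. inv \<pi> \<circ> q \<circ> \<pi>" ?q])
    fix p assume p: "p \<in> {p. p permutes (UNIV :: 'm set)}"
    show "inv \<pi> \<circ> (\<pi> \<circ> p \<circ> inv \<pi>) \<circ> \<pi> = p"
      using inj by (simp add: fun_eq_iff)
    show "?q p \<in> {p. p permutes (UNIV :: 'n set)}"
      using p assms by (auto intro!: bij_imp_permutes bij_comp bij_imp_bij_inv simp: permutes_bij)
    have "sign (?q p) = sign p"
      using sign_map_permutation[of \<pi> UNIV p] p inj by (simp add: mp)
    moreover have "(\<Prod>i\<in>UNIV. A $ \<pi> i $ \<pi> (p i)) = (\<Prod>x\<in>UNIV. A $ x $ ?q p x)"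
      using prod.reindex_bij_betw[OF assms, of "\<lambda>x. A $ x $ ?q p x"] inj by simp
    ultimately show "of_int (sign (?q p)) * (\<Prod>x\<in>UNIV. A $ x $ ?q p x) =
        of_int (sign p) * (\<Prod>i\<in>UNIV. (\<chi> i j. A $ \<pi> i $ \<pi> j) $ i $ p i)"
      by simp
  next
    fix q assume q: "q \<in> {p. p permutes (UNIV :: 'n set)}"
    show "\<pi> \<circ> (inv \<pi> \<circ> q \<circ> \<pi>) \<circ> inv \<pi> = q"
      using surj by (simp add: fun_eq_iff surj_f_inv_f)
    show "inv \<pi> \<circ> q \<circ> \<pi> \<in> {p. p permutes (UNIV :: 'm set)}"
      using q assms by (auto intro!: bij_imp_permutes bij_comp bij_imp_bij_inv simp: permutes_bij)
  qed
qed

definition reindex :: "('m \<Rightarrow> 'n) \<Rightarrow> real ^ 'n \<Rightarrow> real ^ 'm"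
  where "reindex \<pi> u = (\<chi> i. u $ \<pi> i)"

lemma bounded_linear_reindex: "bounded_linear (reindex \<pi> :: real ^ 'n \<Rightarrow> real ^ 'm)"
  unfolding linear_conv_bounded_linear[symmetric]
  by (rule linearI) (simp_all add: reindex_def vec_eq_iff)

lemma reindex_inv:
  assumes "bij \<pi>"
  shows "reindex \<pi> (reindex (inv \<pi>) w) = w" "reindex (inv \<pi>) (reindex \<pi> u) = u"
  using assms by (auto simp: reindex_def vec_eq_iff bij_def surj_f_inv_f)

lemma norm_reindex:
  assumes "bij \<pi>" shows "norm (reindex \<pi> u) = norm u"
  unfolding norm_vec_def L2_set_def reindex_def
  using sum.reindex_bij_betw[OF assms, of "\<lambda>x. (norm (u $ x))\<^sup>2"] by simp

text \<open>Conjugating by the coordinate change relabels rows and columns alike, so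
  \<open>det_reindex\<close> keeps regularity and signs.\<close>

lemma has_jacobian_on_reindex:
  fixes g :: "real ^ 'n \<Rightarrow> real ^ 'n" and \<pi> :: "'m::finite \<Rightarrow> 'n"
  assumes \<pi>: "bij \<pi>" and g: "has_jacobian_on g A S"
  shows "has_jacobian_on (\<lambda>w. reindex \<pi> (g (reindex (inv \<pi>) w)))
    (\<lambda>w. \<chi> i j. A (reindex (inv \<pi>) w) $ \<pi> i $ \<pi> j) (reindex \<pi> ` S)"
    (is "has_jacobian_on _ ?B _")
  unfolding has_jacobian_on_def
proof (intro conjI ballI)
  fix w assume "w \<in> reindex \<pi> ` S"
  then have w: "reindex (inv \<pi>) w \<in> S" using reindex_inv[OF \<pi>] by auto
  have "(reindex (inv \<pi>) has_derivative reindex (inv \<pi>)) (at w)"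
    by (rule bounded_linear_imp_has_derivative[OF bounded_linear_reindex])
  from has_derivative_compose[OF this, of g "(*v) (A (reindex (inv \<pi>) w))"]
  have "((\<lambda>w. g (reindex (inv \<pi>) w)) has_derivative
      (\<lambda>v. A (reindex (inv \<pi>) w) *v reindex (inv \<pi>) v)) (at w)"
    using has_jacobian_onD(1)[OF g w] by blast
  then have "((\<lambda>w. reindex \<pi> (g (reindex (inv \<pi>) w))) has_derivative
      (\<lambda>v. reindex \<pi> (A (reindex (inv \<pi>) w) *v reindex (inv \<pi>) v))) (at w)"
    by (rule bounded_linear.has_derivative[OF bounded_linear_reindex])
  moreover have "reindex \<pi> (A' *v reindex (inv \<pi>) v) = (\<chi> i j. A' $ \<pi> i $ \<pi> j) *v v"
    for A' :: "real ^ 'n ^ 'n" and v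
  proof -
    have "(\<Sum>x\<in>UNIV. A' $ \<pi> i $ x * v $ inv \<pi> x) = (\<Sum>j\<in>UNIV. A' $ \<pi> i $ \<pi> j * v $ j)" for i
      using sum.reindex_bij_betw[OF \<pi>, of "\<lambda>x. A' $ \<pi> i $ x * v $ inv \<pi> x"] \<pi>
      by (simp add: bij_def)
    then show ?thesis by (simp add: reindex_def matrix_vector_mult_def vec_eq_iff)
  qed
  ultimately show "((\<lambda>w. reindex \<pi> (g (reindex (inv \<pi>) w))) has_derivative (*v) (?B w)) (at w)"
    by simp
next
  have "continuous_on (reindex \<pi> ` S) (\<lambda>w. A (reindex (inv \<pi>) w))"
    by (rule continuous_on_compose2[OF has_jacobian_onD(2)[OF g]])
      (use reindex_inv[OF \<pi>] in \<open>auto intro!: linear_continuous_on bounded_linear_reindex\<close>)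
  then show "continuous_on (reindex \<pi> ` S) ?B"
    by (intro continuous_on_matrix_components) (simp add: continuous_intros)
qed

lemma open_reindex:
  fixes \<pi> :: "'m::finite \<Rightarrow> 'n::finite"
  assumes \<pi>: "bij \<pi>" and "open S" shows "open (reindex \<pi> ` S)"
proof -
  have "reindex \<pi> ` S = reindex (inv \<pi>) -` S"
    by (auto simp: reindex_inv[OF \<pi>]) (metis imageI reindex_inv(1)[OF \<pi>])
  then show ?thesis
    using continuous_open_vimage[OF assms(2)] linear_continuous_at[OF bounded_linear_reindex] by metis
qed

lemma signed_count_homotopy:
  fixes g0 g1 :: "real ^ 'n \<Rightarrow> real ^ 'n"
  assumes \<Omega>: "open \<Omega>" and T: "compact T" "T \<subseteq> \<Omega>"
    and g0: "has_jacobian_on g0 A0 \<Omega>" and g1: "has_jacobian_on g1 A1 \<Omega>"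
    and zeros: "\<And>x t. \<lbrakk>x \<in> \<Omega>; 0 \<le> t; t \<le> 1; g0 x + t *\<^sub>R (g1 x - g0 x) = 0\<rbrakk> \<Longrightarrow> x \<in> T"
    and reg0: "\<And>x. x \<in> \<Omega> \<Longrightarrow> g0 x = 0 \<Longrightarrow> det (A0 x) \<noteq> 0"
    and reg1: "\<And>x. x \<in> \<Omega> \<Longrightarrow> g1 x = 0 \<Longrightarrow> det (A1 x) \<noteq> 0"
  shows "(\<Sum>x | x \<in> \<Omega> \<and> g0 x = 0. sgn (det (A0 x))) = (\<Sum>x | x \<in> \<Omega> \<and> g1 x = 0. sgn (det (A1 x)))"
proof -
  obtain \<pi> :: "'n index \<Rightarrow> 'n" where \<pi>: "bij \<pi>" using bij_index by blast
  let ?P = "reindex \<pi>" and ?Q = "reindex (inv \<pi>)"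
  note PQ = reindex_inv[OF \<pi>]
  interpret P: bounded_linear ?P by (rule bounded_linear_reindex)
  have P0: "?P u = 0 \<longleftrightarrow> u = 0" for u
    using norm_reindex[OF \<pi>, of u] by (metis norm_eq_zero)
  have sums: "(\<Sum>w | w \<in> ?P ` \<Omega> \<and> ?P (g (?Q w)) = 0. sgn (det (\<chi> i j. A (?Q w) $ \<pi> i $ \<pi> j))) =
      (\<Sum>x | x \<in> \<Omega> \<and> g x = 0. sgn (det (A x)))" for g :: "real ^ 'n \<Rightarrow> real ^ 'n" and A
    by (rule sum.reindex_bij_witness[of _ ?P ?Q]) (auto simp: PQ P0 det_reindex[OF \<pi>])
  have "(\<Sum>w | w \<in> ?P ` \<Omega> \<and> ?P (g0 (?Q w)) = 0. sgn (det (\<chi> i j. A0 (?Q w) $ \<pi> i $ \<pi> j))) =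
      (\<Sum>w | w \<in> ?P ` \<Omega> \<and> ?P (g1 (?Q w)) = 0. sgn (det (\<chi> i j. A1 (?Q w) $ \<pi> i $ \<pi> j)))"
  proof (rule signed_count_homotopy_wellorder[OF open_reindex[OF \<pi> \<Omega>] _ _
        has_jacobian_on_reindex[OF \<pi> g0] has_jacobian_on_reindex[OF \<pi> g1]])
    show "compact (?P ` T)"
      by (intro compact_continuous_image T linear_continuous_on bounded_linear_reindex)
    show "?P ` T \<subseteq> ?P ` \<Omega>" using T(2) by blast
    show "w \<in> ?P ` T" if "w \<in> ?P ` \<Omega>" "0 \<le> t" "t \<le> 1"
      "?P (g0 (?Q w)) + t *\<^sub>R (?P (g1 (?Q w)) - ?P (g0 (?Q w))) = 0" for w t
    proof -
      have "?P (g0 (?Q w) + t *\<^sub>R (g1 (?Q w) - g0 (?Q w))) = 0"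
        using that(4) by (simp add: P.add P.diff P.scaleR)
      then have "?Q w \<in> T" using zeros[of "?Q w" t] that P0 PQ by auto
      then show ?thesis using PQ(1) by (metis imageI)
    qed
  qed (use reg0 reg1 in \<open>auto simp: PQ P0 det_reindex[OF \<pi>]\<close>)
  then show ?thesis by (simp only: sums)
qed

section \<open>Small regular values\<close>

text \<open>Critical values form a negligible set by Sard's theorem, and such a set cannot fill a
  ball.\<close>

lemma small_regular_value_wellorder:
  fixes g :: "real ^ 'n::{finite,wellorder} \<Rightarrow> real ^ 'n::_"
  assumes g: "has_jacobian_on g A \<Omega>" and e: "e > 0"
  obtains y where "norm y < e" "\<And>x. x \<in> \<Omega> \<Longrightarrow> g x = y \<Longrightarrow> det (A x) \<noteq> 0"
proof -
  define S where "S = {x \<in> \<Omega>. det (A x) = 0}"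
  have "negligible (g ` S)"
  proof (rule baby_Sard)
    show "(g has_derivative (*v) (A x)) (at x within S)" if "x \<in> S" for x
      by (rule has_derivative_at_withinI, rule has_jacobian_onD(1)[OF g])
        (use that in \<open>simp add: S_def\<close>)
    show "rank (matrix ((*v) (A x))) < CARD('n)" if "x \<in> S" for x
      using that by (simp add: S_def det_eq_0_rank)
  qed simp
  moreover have "\<not> negligible (ball (0 :: real ^ 'n::_) e)"
    using e by (intro open_not_negligible) auto
  ultimately obtain y where "y \<in> ball 0 e" "y \<notin> g ` S"
    using negligible_subset by blast
  then show ?thesis using that by (auto simp: S_def)
qed

lemma small_regular_value:
  fixes g :: "real ^ 'n \<Rightarrow> real ^ 'n"
  assumes g: "has_jacobian_on g A \<Omega>" and e: "e > 0"
  obtains y where "norm y < e" "\<And>x. x \<in> \<Omega> \<Longrightarrow> g x = y \<Longrightarrow> det (A x) \<noteq> 0"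
proof -
  obtain \<pi> :: "'n index \<Rightarrow> 'n" where \<pi>: "bij \<pi>" using bij_index by blast
  let ?P = "reindex \<pi>" and ?Q = "reindex (inv \<pi>)"
  note PQ = reindex_inv[OF \<pi>]
  obtain y where y: "norm y < e" "\<And>w. w \<in> ?P ` \<Omega> \<Longrightarrow> ?P (g (?Q w)) = y \<Longrightarrow>
      det (\<chi> i j. A (?Q w) $ \<pi> i $ \<pi> j) \<noteq> 0"
    by (rule small_regular_value_wellorder[OF has_jacobian_on_reindex[OF \<pi> g] e]) blast
  show ?thesis
  proof
    show "norm (?Q y) < e" using y(1) norm_reindex[OF bij_imp_bij_inv[OF \<pi>]] by simp
    show "det (A x) \<noteq> 0" if "x \<in> \<Omega>" "g x = ?Q y" for x
      using y(2)[of "?P x"] that by (simp add: PQ det_reindex[OF \<pi>])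
  qed
qed

section \<open>The Brouwer degree of twice differentiable maps\<close>

text \<open>Links the smoothness in the definition of the degree to that of the integral lemmas:
  \<open>g'\<close> is continuous because it is differentiable.\<close>

lemma C2_on_has_jacobian_on:
  fixes g :: "real ^ 'n \<Rightarrow> real ^ 'n"
  assumes "C2_on g S"
  shows "has_jacobian_on g (\<lambda>x. matrix (frechet_derivative g (at x))) S"
proof -
  obtain g' :: "real ^ 'n \<Rightarrow> (real ^ 'n) \<Rightarrow>\<^sub>L (real ^ 'n)" and g''
    where g': "\<And>x. x \<in> S \<Longrightarrow> (g has_derivative blinfun_apply (g' x)) (at x)"
      and g'': "\<And>x. x \<in> S \<Longrightarrow> (g' has_derivative blinfun_apply (g'' x)) (at x)"
    using assms unfolding C2_on_def by blast
  have eq: "frechet_derivative g (at x) = blinfun_apply (g' x)" if "x \<in> S" for x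
    using frechet_derivative_at[OF g'[OF that]] by simp
  have mat: "(*v) (matrix (blinfun_apply (g' x))) = blinfun_apply (g' x)" for x
    by (rule matrix_vector_mul(3)[OF blinfun.bounded_linear_right])
  have "continuous_on S g'"
    using g'' by (meson continuous_at_imp_continuous_on has_derivative_continuous)
  then have "continuous_on S (\<lambda>x. matrix (blinfun_apply (g' x)))"
    by (intro continuous_on_matrix_components) (auto simp: matrix_def intro!: continuous_intros)
  then have "continuous_on S (\<lambda>x. matrix (frechet_derivative g (at x)))"
    by (simp add: eq cong: continuous_on_cong)
  then show ?thesis
    using g' by (simp add: has_jacobian_on_def eq mat)
qed

lemma C2_on_diff_const:
  assumes "C2_on g S" shows "C2_on (\<lambda>x. g x - c) S"
  using assms unfolding C2_on_def by (fastforce intro: has_derivative_diff[OF _ has_derivative_const, simplified])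

lemma jacobian_det_diff_const: "jacobian_det (\<lambda>x. g x - c) x = jacobian_det g x"
proof -
  have "((\<lambda>x. g x - c) has_derivative f') (at x) \<longleftrightarrow> (g has_derivative f') (at x)" for f'
    using has_derivative_add_const[of g f' "at x" "- c"]
      has_derivative_add_const[of "\<lambda>x. g x - c" f' "at x" c] by auto
  then show ?thesis by (simp add: jacobian_det_def frechet_derivative_def)
qed

text \<open>The pairs in \<open>closure \<Omega> \<times> {0..1}\<close> at which the segment
  vanishes form a compact set. Its projection misses the frontier, so it is a compact subset of
  \<Omega> as \<open>signed_count_homotopy\<close> demands.\<close>

lemma signed_count_boundary_homotopy:
  fixes g0 g1 :: "real ^ 'n \<Rightarrow> real ^ 'n"
  assumes \<Omega>: "open \<Omega>" "bounded \<Omega>"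
    and cont: "continuous_on (closure \<Omega>) g0" "continuous_on (closure \<Omega>) g1"
    and C2: "C2_on g0 \<Omega>" "C2_on g1 \<Omega>"
    and reg: "regular_value g0 \<Omega> 0" "regular_value g1 \<Omega> 0"
    and nz: "\<And>x t. \<lbrakk>x \<in> frontier \<Omega>; 0 \<le> t; t \<le> 1\<rbrakk> \<Longrightarrow> g0 x + t *\<^sub>R (g1 x - g0 x) \<noteq> 0"
  shows "(\<Sum>x | x \<in> \<Omega> \<and> g0 x = 0. sgn (jacobian_det g0 x)) =
    (\<Sum>x | x \<in> \<Omega> \<and> g1 x = 0. sgn (jacobian_det g1 x))"
proof -
  define H where "H z = g0 (fst z) + snd z *\<^sub>R (g1 (fst z) - g0 (fst z))" for z :: "(real ^ 'n) \<times> real"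
  define D where "D = closure \<Omega> \<times> {0..1::real}"
  have "compact D" unfolding D_def by (intro compact_Times) (auto simp: \<Omega>)
  moreover have "continuous_on D H"
    unfolding H_def D_def
    by (intro continuous_intros continuous_on_compose2[OF cont(1)] continuous_on_compose2[OF cont(2)]) auto
  ultimately have "compact (D \<inter> (D \<inter> H -` {0}))"
    by (intro compact_Int_closed continuous_closed_preimage compact_imp_closed) auto
  then have "compact (D \<inter> H -` {0})" by simp
  then have T: "compact (fst ` (D \<inter> H -` {0}))"
    by (intro compact_continuous_image continuous_intros)
  have "fst ` (D \<inter> H -` {0}) \<subseteq> \<Omega>"
  proof
    fix x assume "x \<in> fst ` (D \<inter> H -` {0})"
    then obtain t where t: "x \<in> closure \<Omega>" "0 \<le> t" "t \<le> 1" "H (x, t) = 0"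
      by (auto simp: D_def)
    then have "x \<notin> frontier \<Omega>" using nz[of x t] by (auto simp: H_def)
    then show "x \<in> \<Omega>" using t(1) \<Omega> by (simp add: frontier_def interior_open)
  qed
  then show ?thesis
    unfolding jacobian_det_def
  proof (rule signed_count_homotopy[OF \<Omega>(1) T _ C2_on_has_jacobian_on[OF C2(1)]
        C2_on_has_jacobian_on[OF C2(2)]])
    show "x \<in> fst ` (D \<inter> H -` {0})"
      if "x \<in> \<Omega>" "0 \<le> t" "t \<le> 1" "g0 x + t *\<^sub>R (g1 x - g0 x) = 0" for x t
      using that closure_subset[of \<Omega>] by (intro image_eqI[of _ _ "(x, t)"]) (auto simp: D_def H_def)
  qed (use reg in \<open>auto simp: regular_value_def jacobian_det_def\<close>)
qed

text \<open>As 0 may be a critical value of \<open>f\<close>, the degree is read off from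
  \<open>h = f - y\<close> for a small regular value \<open>y\<close>. Segments without zeros on the
  frontier join \<open>h\<close> to \<open>f1\<close> and every admissible \<open>g\<close> to
  \<open>h\<close>, which gives existence and uniqueness in the definite description.\<close>

lemma brouwer_degree_homotopy_eq:
  fixes f f1 :: "real ^ 'n \<Rightarrow> real ^ 'n"
  assumes \<Omega>: "open \<Omega>" "bounded \<Omega>"
    and cont: "continuous_on (closure \<Omega>) f" "continuous_on (closure \<Omega>) f1"
    and C2: "C2_on f \<Omega>" "C2_on f1 \<Omega>"
    and reg: "regular_value f1 \<Omega> 0"
    and nz: "\<And>x t. \<lbrakk>x \<in> frontier \<Omega>; 0 \<le> t; t \<le> 1\<rbrakk> \<Longrightarrow> f x + t *\<^sub>R (f1 x - f x) \<noteq> 0"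
    and d: "of_int d = (\<Sum>x | x \<in> \<Omega> \<and> f1 x = 0. sgn (jacobian_det f1 x))"
  shows "brouwer_degree f \<Omega> 0 = d"
proof -
  define H where "H z = f (fst z) + snd z *\<^sub>R (f1 (fst z) - f (fst z))" for z :: "(real ^ 'n) \<times> real"
  define D where "D = frontier \<Omega> \<times> {0..1::real}"
  have front: "frontier \<Omega> \<subseteq> closure \<Omega>" by (auto simp: frontier_def)
  have "compact D" unfolding D_def by (intro compact_Times compact_frontier_bounded \<Omega>) auto
  moreover have "continuous_on D H"
    unfolding H_def D_def
    by (intro continuous_intros continuous_on_compose2[OF cont(1)] continuous_on_compose2[OF cont(2)])
      (use front in auto)
  moreover have "H z \<noteq> 0" if "z \<in> D" for z
    using that nz[of "fst z" "snd z"] by (auto simp: D_def H_def)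
  \<comment> \<open>A lower bound for the whole homotopy on the frontier; perturbations smaller than
    \<open>e\<close> create no zeros there.\<close>
  ultimately obtain e where e: "e > 0" "\<And>z. z \<in> D \<Longrightarrow> e \<le> norm (H z)"
    using compact_norm_bounded_below[of D H] by blast
  obtain y where y: "norm y < e" "\<And>x. x \<in> \<Omega> \<Longrightarrow> f x = y \<Longrightarrow> jacobian_det f x \<noteq> 0"
    unfolding jacobian_det_def by (rule small_regular_value[OF C2_on_has_jacobian_on[OF C2(1)] e(1)]) blast
  define h where "h x = f x - y" for x
  have h: "continuous_on (closure \<Omega>) h" "C2_on h \<Omega>" "regular_value h \<Omega> 0"
    unfolding h_def[abs_def] using cont y(2)
    by (auto intro!: continuous_intros C2_on_diff_const C2 simp: regular_value_def jacobian_det_diff_const)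
  have fe: "norm y < norm (f x)" if "x \<in> frontier \<Omega>" for x
    using e(2)[of "(x, 0)"] y(1) that by (simp add: D_def H_def)
  have count_h: "(\<Sum>x | x \<in> \<Omega> \<and> h x = 0. sgn (jacobian_det h x)) = of_int d"
    unfolding d
  proof (rule signed_count_boundary_homotopy[OF \<Omega> h(1) cont(2) h(2) C2(2) h(3) reg])
    show "h x + t *\<^sub>R (f1 x - h x) \<noteq> 0" if "x \<in> frontier \<Omega>" "0 \<le> t" "t \<le> 1" for x t
    proof
      assume "h x + t *\<^sub>R (f1 x - h x) = 0"
      \<comment> \<open>Replacing \<open>f\<close> by \<open>h\<close> shifts the homotopy by
        \<open>(1 - t) *\<^sub>R y\<close>, which is shorter than \<open>e\<close>.\<close>
      then have "H (x, t) = (1 - t) *\<^sub>R y" by (simp add: h_def H_def algebra_simps)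
      then have "norm (H (x, t)) \<le> norm y"
        using that mult_left_le_one_le[of "norm y" "1 - t"] by simp
      then show False using e(2)[of "(x, t)"] y(1) that by (simp add: D_def)
    qed
  qed
  show ?thesis
    unfolding brouwer_degree_def
  proof (rule the_equality)
    show "\<exists>g. continuous_on (closure \<Omega>) g \<and> C2_on g \<Omega> \<and>
        (\<forall>x\<in>closure \<Omega>. \<forall>z\<in>frontier \<Omega>. dist (g x) (f x) < dist 0 (f z)) \<and>
        regular_value g \<Omega> 0 \<and> of_int d = (\<Sum>x | x \<in> \<Omega> \<and> g x = 0. sgn (jacobian_det g x))"
      using h count_h fe by (intro exI[of _ h]) (auto simp: h_def dist_norm)
  next
    fix d' assume "\<exists>g. continuous_on (closure \<Omega>) g \<and> C2_on g \<Omega> \<and>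
        (\<forall>x\<in>closure \<Omega>. \<forall>z\<in>frontier \<Omega>. dist (g x) (f x) < dist 0 (f z)) \<and>
        regular_value g \<Omega> 0 \<and> of_int d' = (\<Sum>x | x \<in> \<Omega> \<and> g x = 0. sgn (jacobian_det g x))"
    then obtain g where g: "continuous_on (closure \<Omega>) g" "C2_on g \<Omega>" "regular_value g \<Omega> 0"
      and near: "\<And>x. x \<in> frontier \<Omega> \<Longrightarrow> norm (g x - f x) < norm (f x)"
      and d': "of_int d' = (\<Sum>x | x \<in> \<Omega> \<and> g x = 0. sgn (jacobian_det g x))"
      using front by (auto simp: dist_norm)
    have "(\<Sum>x | x \<in> \<Omega> \<and> g x = 0. sgn (jacobian_det g x)) =
        (\<Sum>x | x \<in> \<Omega> \<and> h x = 0. sgn (jacobian_det h x))"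
    proof (rule signed_count_boundary_homotopy[OF \<Omega> g(1) h(1) g(2) h(2) g(3) h(3)])
      show "g x + t *\<^sub>R (h x - g x) \<noteq> 0" if "x \<in> frontier \<Omega>" "0 \<le> t" "t \<le> 1" for x t
      proof
        assume "g x + t *\<^sub>R (h x - g x) = 0"
        \<comment> \<open>\<open>g x - f x\<close> and \<open>- y\<close> both lie in the open ball
          of radius \<open>norm (f x)\<close>, which is convex; a zero would put
          \<open>- f x\<close> into it.\<close>
        then have "- f x = (1 - t) *\<^sub>R (g x - f x) + t *\<^sub>R (- y)"
          by (simp add: h_def algebra_simps)
        moreover have "(1 - t) *\<^sub>R (g x - f x) + t *\<^sub>R (- y) \<in> ball 0 (norm (f x))"
          by (rule convexD_alt[OF convex_ball]) (use near[of x] fe[of x] that in auto)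
        ultimately show False by (metis dist_0_norm less_irrefl mem_ball norm_minus_cancel)
      qed
    qed
    then have "(of_int d' :: real) = of_int d" by (simp add: d' count_h)
    then show "d' = d" by simp
  qed
qed

section \<open>The sinh-Gordon map\<close>

lemma C2_on_continuous_on:
  assumes "C2_on g S" shows "continuous_on S g"
  using assms unfolding C2_on_def
  by (meson continuous_at_imp_continuous_on has_derivative_continuous)

lemma C2_on_add:
  assumes "C2_on f S" "C2_on g S" shows "C2_on (\<lambda>x. f x + g x) S"
proof -
  obtain f' f'' where f: "\<And>x. x \<in> S \<Longrightarrow> (f has_derivative blinfun_apply (f' x)) (at x)"
    "\<And>x. x \<in> S \<Longrightarrow> (f' has_derivative blinfun_apply (f'' x)) (at x)" "continuous_on S f''"
    using assms(1) unfolding C2_on_def by blast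
  obtain g' g'' where g: "\<And>x. x \<in> S \<Longrightarrow> (g has_derivative blinfun_apply (g' x)) (at x)"
    "\<And>x. x \<in> S \<Longrightarrow> (g' has_derivative blinfun_apply (g'' x)) (at x)" "continuous_on S g''"
    using assms(2) unfolding C2_on_def by blast
  show ?thesis
    unfolding C2_on_def
  proof (intro exI conjI ballI)
    fix x assume x: "x \<in> S"
    show "((\<lambda>x. f x + g x) has_derivative blinfun_apply (f' x + g' x)) (at x)"
      using has_derivative_add[OF f(1) g(1), OF x x] by (simp add: plus_blinfun.rep_eq)
    show "((\<lambda>x. f' x + g' x) has_derivative blinfun_apply (f'' x + g'' x)) (at x)"
      using has_derivative_add[OF f(2) g(2), OF x x] by (simp add: plus_blinfun.rep_eq)
  next
    show "continuous_on S (\<lambda>x. f'' x + g'' x)" by (intro continuous_intros f g)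
  qed
qed

lemma C2_on_bounded_linear:
  assumes "bounded_linear f" shows "C2_on f S"
  unfolding C2_on_def
proof (intro exI conjI ballI)
  fix x
  show "(f has_derivative blinfun_apply (Blinfun f)) (at x)"
    using assms by (simp add: bounded_linear_Blinfun_apply bounded_linear_imp_has_derivative)
  show "((\<lambda>_. Blinfun f) has_derivative blinfun_apply 0) (at x)"
    by (simp add: zero_blinfun.rep_eq)
qed (rule continuous_on_const)

lemma C2_on_const: "C2_on (\<lambda>_. c) S"
  using C2_on_diff_const[OF C2_on_bounded_linear[OF bounded_linear_zero], of "- c" S] by simp

lemma C2_on_sum:
  assumes "\<And>i. i \<in> I \<Longrightarrow> C2_on (f i) S"
  shows "C2_on (\<lambda>x. \<Sum>i\<in>I. f i x) S"
  using assms by (induction I rule: infinite_finite_induct) (auto intro: C2_on_const C2_on_add)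

text \<open>Differentiating the exponential times a constant gives the same exponential times a
  constant linear map, so the one formula \<open>deriv\<close>, used at \<open>b\<close> and at
  \<open>D\<close>, yields both derivatives.\<close>

lemma C2_on_exp_coordinate: "C2_on (\<lambda>u :: real ^ 'n. exp (a * u $ i) *\<^sub>R b) S"
proof -
  let ?e = "\<lambda>u :: real ^ 'n. exp (a * u $ i)"
  define D where "D = Blinfun (\<lambda>v :: real ^ 'n. (a * v $ i) *\<^sub>R b)"
  define D2 where "D2 = Blinfun (\<lambda>v :: real ^ 'n. (a * v $ i) *\<^sub>R D)"
  have bl: "bounded_linear (\<lambda>v :: real ^ 'n. (a * v $ i) *\<^sub>R z)" for z :: "'z::real_normed_vector"
    by (intro bounded_linear_intros bounded_linear_vec_nth)
  have apply_D: "blinfun_apply D v = (a * v $ i) *\<^sub>R b" "blinfun_apply D2 v = (a * v $ i) *\<^sub>R D" for v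
    unfolding D_def D2_def by (simp_all add: bounded_linear_Blinfun_apply bl)
  have deriv: "((\<lambda>u. ?e u *\<^sub>R z) has_derivative (\<lambda>v. ?e u *\<^sub>R ((a * v $ i) *\<^sub>R z))) (at u)"
    for u and z :: "'z::real_normed_vector"
    by (auto intro!: derivative_eq_intros bounded_linear.has_derivative[OF bounded_linear_vec_nth]
        simp: mult_ac)
  show ?thesis
    unfolding C2_on_def
  proof (intro exI conjI ballI)
    fix u
    show "((\<lambda>u. ?e u *\<^sub>R b) has_derivative blinfun_apply (?e u *\<^sub>R D)) (at u)"
      using deriv[of b u] by (simp add: scaleR_blinfun.rep_eq apply_D)
    show "((\<lambda>u. ?e u *\<^sub>R D) has_derivative blinfun_apply (?e u *\<^sub>R D2)) (at u)"
      using deriv[of D u] by (simp add: scaleR_blinfun.rep_eq apply_D)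
  qed (intro continuous_intros)
qed

lemma bounded_linear_laplacian: "bounded_linear (laplacian E \<omega> \<mu>)"
  unfolding linear_conv_bounded_linear[symmetric]
  by (rule linearI)
    (simp_all add: laplacian_def vec_eq_iff algebra_simps sum_distrib_left flip: sum.distrib sum_subtractf)

lemma C2_on_sinh_gordon_map: "C2_on (sinh_gordon_map E \<omega> \<mu> hp hm c) S"
proof -
  \<comment> \<open>With axis vectors each nonlinear term is an exponential of one coordinate times
    a fixed vector; the factors \<open>1\<close> and \<open>- 1\<close> match
    \<open>C2_on_exp_coordinate\<close>.\<close>
  have eq: "sinh_gordon_map E \<omega> \<mu> hp hm c = (\<lambda>u. - laplacian E \<omega> \<mu> u +
      ((\<Sum>x\<in>UNIV. exp (1 * u $ x) *\<^sub>R (- hp x *\<^sub>R axis x 1)) +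
       ((\<Sum>x\<in>UNIV. exp (- 1 * u $ x) *\<^sub>R (- hm x *\<^sub>R axis x 1)) + (\<chi> x. c))))"
    by (auto simp: sinh_gordon_map_def vec_eq_iff fun_eq_iff axis_def if_distrib
        sum.delta' mult.commute cong: if_cong)
  show ?thesis
    unfolding eq by (intro C2_on_add C2_on_sum C2_on_const C2_on_exp_coordinate
        C2_on_bounded_linear[OF bounded_linear_minus[OF bounded_linear_laplacian]])
qed

section \<open>The decoupled comparison map\<close>

text \<open>As a sinh-Gordon map without edges it inherits smoothness. Vertices with
  \<open>hp x = 0\<close> count as negative and those with \<open>hm x = 0\<close> as positive, in
  line with the strict inequalities of the degree formula.\<close>

definition decoupled_map :: "('v::finite \<Rightarrow> real) \<Rightarrow> ('v \<Rightarrow> real) \<Rightarrow> real ^ 'v \<Rightarrow> real ^ 'v"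
  where "decoupled_map hp hm = sinh_gordon_map {} (\<lambda>_ _. 0) (\<lambda>_. 1)
    (\<lambda>x. if hp x > 0 then 1 else - 1) (\<lambda>x. if hm x < 0 then - 1 else 1) 0"

lemma decoupled_map_nth: "decoupled_map hp hm u $ x =
    - (if hp x > 0 then 1 else - 1) * exp (u $ x) - (if hm x < 0 then - 1 else 1) * exp (- (u $ x))"
  by (simp add: decoupled_map_def sinh_gordon_map_def laplacian_def)

text \<open>Where the two coefficients have equal signs, the coordinate is plus or minus a sum of
  positive exponentials and never vanishes; with opposite signs it is a nonzero multiple of
  \<open>sinh (u $ x)\<close>.\<close>

lemma decoupled_map_eq_0_iff:
  "decoupled_map hp hm u = 0 \<longleftrightarrow> {x. hp x > 0} = {x. hm x < 0} \<and> u = 0"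
proof
  assume "decoupled_map hp hm u = 0"
  then have eq: "decoupled_map hp hm u $ x = 0" for x by simp
  have sums: "exp (u $ x) + exp (- (u $ x)) > 0" for x by (simp add: add_pos_pos)
  have signs: "hp x > 0 \<longleftrightarrow> hm x < 0" for x
    using eq[of x] sums[of x] by (auto simp: decoupled_map_nth split: if_splits)
  moreover have "u $ x = 0" for x
  proof -
    have "exp (u $ x) = exp (- (u $ x))"
      using eq[of x] signs[of x] by (auto simp: decoupled_map_nth split: if_splits)
    then show ?thesis by simp
  qed
  ultimately show "{x. hp x > 0} = {x. hm x < 0} \<and> u = 0" by (auto simp: vec_eq_iff)
next
  assume "{x. hp x > 0} = {x. hm x < 0} \<and> u = 0"
  then show "decoupled_map hp hm u = 0" by (auto simp: vec_eq_iff decoupled_map_nth)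
qed

text \<open>Coordinate \<open>x\<close> is \<open>- 2 * \<sigma> x * sinh (u $ x)\<close>, so the
  Jacobian at 0 is diagonal with one negative entry for each vertex where
  \<open>hp x > 0\<close>.\<close>

lemma sgn_jacobian_decoupled_map:
  assumes eq: "{x. hp x > 0} = {x. hm x < 0}"
  shows "sgn (jacobian_det (decoupled_map hp hm) 0) = (- 1) ^ card {x. hp x > 0}"
proof -
  define \<sigma> :: "'a \<Rightarrow> real" where "\<sigma> x = (if hp x > 0 then 1 else - 1)" for x
  have signs: "hp x > 0 \<longleftrightarrow> hm x < 0" for x using eq by auto
  define A where "A = (\<chi> x y. if x = y then - 2 * \<sigma> x else 0)"
  have "((\<lambda>u. decoupled_map hp hm u $ x) has_derivative (\<lambda>v. - 2 * \<sigma> x * v $ x)) (at 0)" for x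
    unfolding decoupled_map_nth \<sigma>_def signs
    by (auto intro!: derivative_eq_intros bounded_linear.has_derivative[OF bounded_linear_vec_nth])
  moreover have "- 2 * \<sigma> x * v $ x = (A *v v) $ x" for x v
    by (simp add: A_def matrix_vector_mult_def if_distrib[of "\<lambda>a. a * _"] cong: if_cong)
  ultimately have "(decoupled_map hp hm has_derivative (*v) A) (at 0)"
    unfolding has_derivative_componentwise_within[where f = "decoupled_map hp hm"]
    by (auto simp: Basis_vec_def inner_axis)
  then have "jacobian_det (decoupled_map hp hm) 0 = det A"
    unfolding jacobian_det_def by (simp flip: frechet_derivative_at)
  also have "\<dots> = (\<Prod>x\<in>UNIV. - 2 * \<sigma> x)"
    by (subst det_diagonal) (auto simp: A_def)
  finally have det_eq: "jacobian_det (decoupled_map hp hm) 0 = (\<Prod>x\<in>UNIV. - 2 * \<sigma> x)" .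
  have sgn_prod: "sgn (\<Prod>x\<in>I. f x) = (\<Prod>x\<in>I. sgn (f x))" for f :: "'a \<Rightarrow> real" and I
    by (induction I rule: infinite_finite_induct) (auto simp: sgn_mult)
  have "sgn (jacobian_det (decoupled_map hp hm) 0) = (\<Prod>x\<in>UNIV. sgn (- 2 * \<sigma> x))"
    unfolding det_eq by (rule sgn_prod)
  also have "\<dots> = (\<Prod>x\<in>UNIV. if x \<in> {x. hp x > 0} then - 1 else 1)"
    by (intro prod.cong) (auto simp: \<sigma>_def)
  also have "\<dots> = (- 1) ^ card {x. hp x > 0}"
    by (subst prod.If_cases) auto
  finally show ?thesis .
qed

section \<open>A priori bounds for zeros along the homotopy\<close>

text \<open>The negative Laplacian at \<open>y\<close> is a weighted sum of differences
  \<open>u $ y - u $ w\<close>, none below \<open>- C\<close>. An upper bound on the sum therefore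
  bounds each single difference, uniformly in \<open>u\<close> and \<open>M\<close>.\<close>

lemma near_maximum_propagates:
  assumes "weighted_graph E \<omega> \<mu>" and yz: "(y, z) \<in> E" and C: "C \<ge> 0" and B: "B \<ge> 0"
  obtains C' where "C' \<ge> 0"
    "\<And>u M. \<lbrakk>\<And>w. u $ w \<le> M; u $ y \<ge> M - C; - (laplacian E \<omega> \<mu> u $ y) \<le> B\<rbrakk> \<Longrightarrow> u $ z \<ge> M - C'"
proof -
  interpret weighted_graph E \<omega> \<mu> by fact
  define N where "N = {w. (y, w) \<in> E}"
  have \<omega>yz: "\<omega> y z > 0" using yz weight_pos_iff by blast
  define K where "K = B * \<mu> y + C * (\<Sum>w\<in>N. \<omega> y w)"
  have "K \<ge> 0"
    unfolding K_def using B C measure_pos[of y] weight_nonneg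
    by (intro add_nonneg_nonneg mult_nonneg_nonneg sum_nonneg) (auto simp: less_imp_le)
  show ?thesis
  proof
    show "C + K / \<omega> y z \<ge> 0" using C \<open>K \<ge> 0\<close> \<omega>yz by simp
    fix u :: "real ^ 'a" and M
    assume u: "\<And>w. u $ w \<le> M" "u $ y \<ge> M - C" "- (laplacian E \<omega> \<mu> u $ y) \<le> B"
    have "- (laplacian E \<omega> \<mu> u $ y) = (\<Sum>w\<in>N. \<omega> y w * (u $ y - u $ w)) / \<mu> y"
      by (simp add: laplacian_def N_def algebra_simps sum_subtractf sum_negf diff_divide_distrib)
    then have "(\<Sum>w\<in>N. \<omega> y w * (u $ y - u $ w)) \<le> B * \<mu> y"
      using u(3) measure_pos[of y] by (simp add: pos_divide_le_eq)
    \<comment> \<open>Adding \<open>C\<close> makes every summand nonnegative, so one of them is at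
      most the sum; \<open>K\<close> accounts for the shift.\<close>
    then have "(\<Sum>w\<in>N. \<omega> y w * (u $ y - u $ w + C)) \<le> K"
      by (simp add: K_def distrib_left sum.distrib sum_distrib_left mult.commute)
    moreover have "\<omega> y z * (u $ y - u $ z + C) \<le> (\<Sum>w\<in>N. \<omega> y w * (u $ y - u $ w + C))"
    proof (rule member_le_sum)
      show "z \<in> N" using yz by (simp add: N_def)
      show "0 \<le> \<omega> y w * (u $ y - u $ w + C)" for w
        using u(1)[of w] u(2) weight_nonneg by (intro mult_nonneg_nonneg) auto
    qed simp
    ultimately have "u $ y - u $ z + C \<le> K / \<omega> y z"
      using \<omega>yz by (simp add: pos_le_divide_eq mult.commute)
    then show "u $ z \<ge> M - (C + K / \<omega> y z)" using u(1)[of y] u(2) by linarith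
  qed
qed

text \<open>Reflection exchanges the two exponentials, so a lower bound for zeros becomes an upper
  bound for the reflected problem.\<close>

lemma sinh_gordon_map_uminus:
  "sinh_gordon_map E \<omega> \<mu> (\<lambda>x. - hm x) (\<lambda>x. - hp x) (- c) (- u) = - sinh_gordon_map E \<omega> \<mu> hp hm c u"
proof -
  have "laplacian E \<omega> \<mu> (- u) = - laplacian E \<omega> \<mu> u"
    by (simp add: bounded_linear.linear bounded_linear_laplacian linear_neg)
  then show ?thesis by (simp add: sinh_gordon_map_def vec_eq_iff)
qed

lemma decoupled_map_uminus:
  "decoupled_map (\<lambda>x. - hm x) (\<lambda>x. - hp x) (- u) = - decoupled_map hp hm u"
  by (simp add: vec_eq_iff decoupled_map_nth)

text \<open>With \<open>s = M - C\<close>, the quadratic lower bound of \<open>exp\<close> gives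
  \<open>s\<^sup>2 \<le> p * s + q\<close>, which fails once \<open>s > p + q + 1\<close>.\<close>

lemma exp_dominates_linear:
  fixes D K d :: real
  assumes d: "d > 0" and D: "D \<ge> 0" and K: "K \<ge> 0" and C: "C \<ge> 0" and M: "M \<ge> 0"
    and le: "d * exp (M - C) \<le> D * M + K"
  shows "M \<le> C + 2 * D / d + 2 * (D * C + K) / d + 1"
proof (rule ccontr)
  define s where "s = M - C"
  define p where "p = 2 * D / d"
  define q where "q = 2 * (D * C + K) / d"
  assume "\<not> ?thesis"
  then have s: "s > p + q + 1" by (simp add: s_def p_def q_def)
  have pq: "p \<ge> 0" "q \<ge> 0" using d D K C by (auto simp: p_def q_def)
  have "s\<^sup>2 / 2 \<le> exp s"
    using exp_lower_Taylor_quadratic[of s] s pq by linarith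
  then have "d * (s\<^sup>2 / 2) \<le> d * exp s" using d by simp
  also have "\<dots> \<le> D * (s + C) + K" using le by (simp add: s_def)
  finally have "s\<^sup>2 \<le> p * s + q"
    using d by (simp add: p_def q_def field_simps)
  moreover have "(p + q) * s < s * s" using s pq by (intro mult_strict_right_mono) auto
  moreover have "q \<le> q * s" using s pq by (intro mult_left_le[THEN order_trans] mult_left_mono[of 1 s q, simplified]) auto
  ultimately show False by (simp add: power2_eq_square algebra_simps)
qed

text \<open>Walk along a path from the maximum point to \<open>xs\<close>: while \<open>hp\<close>
  vanishes, the Laplacian bound passes closeness to the maximum on to the next vertex. At
  \<open>xs\<close> at the latest, \<open>hp\<close> is nonzero.\<close>

lemma near_maximum_active:
  fixes hp hm :: "'v::finite \<Rightarrow> real" and K :: real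
  assumes G: "weighted_graph E \<omega> \<mu>" and xs: "hp xs \<noteq> 0" and K: "K \<ge> 0"
  obtains C where "C \<ge> 0"
    "\<And>(u :: real ^ 'v) x0. \<lbrakk>\<And>w. u $ w \<le> u $ x0; u $ x0 \<ge> 0;
        \<And>y. hp y = 0 \<Longrightarrow> - (laplacian E \<omega> \<mu> u $ y) \<le> K * exp (- (u $ y)) + K\<rbrakk> \<Longrightarrow>
      \<exists>z. hp z \<noteq> 0 \<and> u $ z \<ge> u $ x0 - C"
proof -
  define P where "P u x0 \<longleftrightarrow> (\<forall>w. u $ w \<le> u $ x0) \<and> u $ x0 \<ge> 0 \<and>
    (\<forall>y. hp y = 0 \<longrightarrow> - (laplacian E \<omega> \<mu> u $ y) \<le> K * exp (- (u $ y)) + K)" for u x0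
  have "\<exists>C\<ge>0. \<forall>u. P u x0 \<longrightarrow> (\<exists>z. hp z \<noteq> 0 \<and> u $ z \<ge> u $ x0 - C) \<or> u $ y \<ge> u $ x0 - C"
    if "(x0, y) \<in> E\<^sup>*" for x0 y
    using that
  proof (induction rule: rtrancl_induct)
    case base
    show ?case by (rule exI[of _ 0]) auto
  next
    case (step y z)
    then obtain C where C: "C \<ge> 0" "\<And>u. P u x0 \<Longrightarrow>
        (\<exists>z. hp z \<noteq> 0 \<and> u $ z \<ge> u $ x0 - C) \<or> u $ y \<ge> u $ x0 - C" by blast
    obtain C' where C': "C' \<ge> 0" "\<And>u M. \<lbrakk>\<And>w. u $ w \<le> M; u $ y \<ge> M - C;
        - (laplacian E \<omega> \<mu> u $ y) \<le> K * exp C + K\<rbrakk> \<Longrightarrow> u $ z \<ge> M - C'"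
      by (rule near_maximum_propagates[OF G step.hyps(2) C(1), of "K * exp C + K"])
        (use K in auto)
    show ?case
    proof (intro exI[of _ "max C C'"] conjI allI impI)
      show "max C C' \<ge> 0" using C(1) by simp
      fix u assume u: "P u x0"
      show "(\<exists>z. hp z \<noteq> 0 \<and> u $ z \<ge> u $ x0 - max C C') \<or> u $ z \<ge> u $ x0 - max C C'"
      proof (cases "(\<exists>z. hp z \<noteq> 0 \<and> u $ z \<ge> u $ x0 - C)")
        case True
        then obtain z' where "hp z' \<noteq> 0" "u $ z' \<ge> u $ x0 - C" by blast
        then show ?thesis by (intro disjI1 exI[of _ z']) auto
      next
        case False
        then have y: "u $ y \<ge> u $ x0 - C" and hpy: "hp y = 0" using C(2)[OF u] by auto
        \<comment> \<open>The maximum is nonnegative, so closeness to it bounds the decaying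
          exponential independently of \<open>u\<close>.\<close>
        have "- (u $ y) \<le> C" using y u by (auto simp: P_def)
        then have "K * exp (- (u $ y)) \<le> K * exp C" using K by (intro mult_left_mono) auto
        then have "- (laplacian E \<omega> \<mu> u $ y) \<le> K * exp C + K"
          using u hpy unfolding P_def by fastforce
        then have "u $ z \<ge> u $ x0 - C'" using u y by (intro C'(2)) (auto simp: P_def)
        then show ?thesis by auto
      qed
    qed
  qed
  then have "\<exists>C\<ge>0. \<forall>u. P u x0 \<longrightarrow> (\<exists>z. hp z \<noteq> 0 \<and> u $ z \<ge> u $ x0 - C)" for x0
    using weighted_graph.connected[OF G, of x0 xs] xs by blast
  then obtain C where C: "\<And>x0. C x0 \<ge> 0"
      "\<And>x0 u. P u x0 \<Longrightarrow> \<exists>z. hp z \<noteq> 0 \<and> u $ z \<ge> u $ x0 - C x0"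
    by metis
  show ?thesis
  proof
    show "(\<Sum>x\<in>UNIV. C x) \<ge> 0" using C(1) by (simp add: sum_nonneg)
    fix u :: "real ^ 'v" and x0
    assume "\<And>w. u $ w \<le> u $ x0" "u $ x0 \<ge> 0"
      "\<And>y. hp y = 0 \<Longrightarrow> - (laplacian E \<omega> \<mu> u $ y) \<le> K * exp (- (u $ y)) + K"
    then have "P u x0" by (simp add: P_def)
    then obtain z where z: "hp z \<noteq> 0" "u $ z \<ge> u $ x0 - C x0" using C(2) by blast
    have "C x0 \<le> (\<Sum>x\<in>UNIV. C x)" using C(1) by (intro member_le_sum) auto
    then show "\<exists>z. hp z \<noteq> 0 \<and> u $ z \<ge> u $ x0 - (\<Sum>x\<in>UNIV. C x)"
      using z by (intro exI[of _ z]) auto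
  qed
qed

text \<open>At a vertex within \<open>C\<close> of the maximum \<open>M\<close> with
  \<open>a t z\<close> at least \<delta> in size, the growing exponential is at least
  \<open>\<delta> * exp (M - C)\<close>, the other terms at most linear in \<open>M\<close>. For
  \<open>t \<ge> 1/2\<close> the maximum point qualifies; otherwise
  \<open>near_maximum_active\<close> finds a vertex.\<close>

lemma homotopy_zeros_one_sided_bound:
  fixes hp hm :: "'v::finite \<Rightarrow> real"
  assumes G: "weighted_graph E \<omega> \<mu>" and hp: "\<exists>x. hp x \<noteq> 0"
  obtains R where "\<And>t u x0. \<lbrakk>0 \<le> t; t \<le> 1;
      sinh_gordon_map E \<omega> \<mu> hp hm c u +
        t *\<^sub>R (decoupled_map hp hm u - sinh_gordon_map E \<omega> \<mu> hp hm c u) = 0;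
      \<And>w. \<bar>u $ w\<bar> \<le> u $ x0\<rbrakk> \<Longrightarrow> u $ x0 \<le> R"
proof -
  interpret weighted_graph E \<omega> \<mu> by fact
  obtain xs where xs: "hp xs \<noteq> 0" using hp by blast
  define a where "a t x = (1 - t) * hp x + t * (if hp x > 0 then 1 else - 1)" for t x
  define b where "b t x = (1 - t) * hm x + t * (if hm x < 0 then - 1 else 1)" for t x
  \<comment> \<open>Half the smallest nonzero \<open>\<bar>hp x\<bar>\<close>, capped at 1/2 to
    serve also for vertices with \<open>hp x = 0\<close> once \<open>t \<ge> 1/2\<close>.\<close>
  define \<delta> where "\<delta> = min 1 (Min ((\<lambda>x. \<bar>hp x\<bar>) ` {x. hp x \<noteq> 0})) / 2"
  have "Min ((\<lambda>x. \<bar>hp x\<bar>) ` {x. hp x \<noteq> 0}) > 0" using xs by (subst Min_gr_iff) auto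
  then have \<delta>: "\<delta> > 0" "2 * \<delta> \<le> 1" by (auto simp: \<delta>_def)
  have hp_\<delta>: "2 * \<delta> \<le> \<bar>hp x\<bar>" if "hp x \<noteq> 0" for x
    using that by (auto simp: \<delta>_def intro!: min.coboundedI2 Min_le)
  define \<beta> where "\<beta> = 1 + (\<Sum>x\<in>UNIV. \<bar>hm x\<bar>)"
  have \<beta>: "\<beta> \<ge> 0" "\<bar>hm x\<bar> \<le> \<beta>" "1 \<le> \<beta>" for x
  proof -
    have "\<bar>hm x\<bar> \<le> (\<Sum>x\<in>UNIV. \<bar>hm x\<bar>)" by (rule member_le_sum) auto
    moreover have "0 \<le> (\<Sum>x\<in>UNIV. \<bar>hm x\<bar>)" by (simp add: sum_nonneg)
    ultimately show "\<beta> \<ge> 0" "\<bar>hm x\<bar> \<le> \<beta>" "1 \<le> \<beta>" by (auto simp: \<beta>_def)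
  qed
  have b_le: "\<bar>b t x\<bar> \<le> \<beta>" if t: "0 \<le> t" "t \<le> 1" for t x
  proof -
    have "\<bar>b t x\<bar> \<le> (1 - t) * \<bar>hm x\<bar> + t * 1"
      unfolding b_def using t by (intro abs_triangle_ineq[THEN order_trans] add_mono) (auto simp: abs_mult)
    also have "\<dots> \<le> (1 - t) * \<beta> + t * \<beta>" using t \<beta> by (intro add_mono mult_left_mono) auto
    finally show ?thesis by (simp add: algebra_simps)
  qed
  \<comment> \<open>No cancellation: the comparison sign agrees with that of \<open>hp x\<close>
    wherever this is nonzero, so absolute values add.\<close>
  have active: "\<bar>a t x\<bar> \<ge> \<delta>" if t: "0 \<le> t" "t \<le> 1" and x: "hp x \<noteq> 0 \<or> t \<ge> 1/2" for t x
  proof -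
    define m where "m = \<bar>hp x\<bar>"
    have "\<bar>a t x\<bar> = (1 - t) * m + t"
    proof (cases "hp x > 0")
      case True
      then show ?thesis using t by (simp add: a_def m_def)
    next
      case False
      then have "a t x = - ((1 - t) * m + t)" by (simp add: a_def m_def)
      moreover have "(1 - t) * m + t \<ge> 0" using t by (simp add: m_def)
      ultimately show ?thesis by simp
    qed
    moreover have "(1 - t) * m + t \<ge> \<delta>"
    proof (cases "t \<ge> 1/2")
      case True
      have "(1 - t) * m \<ge> 0" using t by (simp add: m_def)
      then show ?thesis using True \<delta> by linarith
    next
      case False
      then have "m \<ge> 2 * \<delta>" using x hp_\<delta> by (auto simp: m_def)
      then have "(1 - t) * m \<ge> (1 - t) * (2 * \<delta>)" using t by (intro mult_left_mono) auto
      moreover have "t \<ge> t * (2 * \<delta>)" using t \<delta> by (simp add: mult_left_le)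
      ultimately have "(1 - t) * m + t \<ge> 2 * \<delta>" by (simp add: algebra_simps)
      then show ?thesis using \<delta>(1) by linarith
    qed
    ultimately show ?thesis by simp
  qed
  \<comment> \<open>The factor 2 comes from dividing by \<open>1 - t > 1/2\<close>.\<close>
  define K where "K = 2 * \<beta> + 2 * \<bar>c\<bar>"
  have K: "K \<ge> 0" using \<beta>(1) by (simp add: K_def)
  obtain C where C: "C \<ge> 0" "\<And>(u :: real ^ 'v) x0. \<lbrakk>\<And>w. u $ w \<le> u $ x0; u $ x0 \<ge> 0;
        \<And>y. hp y = 0 \<Longrightarrow> - (laplacian E \<omega> \<mu> u $ y) \<le> K * exp (- (u $ y)) + K\<rbrakk> \<Longrightarrow>
      \<exists>z. hp z \<noteq> 0 \<and> u $ z \<ge> u $ x0 - C"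
    by (rule near_maximum_active[where hp = hp, OF G xs K]) blast
  \<comment> \<open>Bounds the Laplacian in the maximum norm: values of \<open>u\<close> differ by
    at most twice the maximum, and the sum over \<open>z\<close> covers all vertices.\<close>
  define D where "D = (\<Sum>z\<in>UNIV. (1 / \<mu> z) * (\<Sum>w | (z, w) \<in> E. \<omega> z w * 2))"
  have D_term: "(1 / \<mu> z) * (\<Sum>w | (z, w) \<in> E. \<omega> z w * 2) \<ge> 0" for z
    using measure_pos[of z] weight_nonneg by (intro mult_nonneg_nonneg sum_nonneg) auto
  have D: "D \<ge> 0" unfolding D_def by (intro sum_nonneg D_term)
  have lap: "\<bar>laplacian E \<omega> \<mu> u $ z\<bar> \<le> D * M" if u: "\<And>w. \<bar>u $ w\<bar> \<le> M" for u z M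
  proof -
    have M: "M \<ge> 0" using u[of z] by linarith
    have "\<bar>laplacian E \<omega> \<mu> u $ z\<bar> = (1 / \<mu> z) * \<bar>\<Sum>w | (z, w) \<in> E. \<omega> z w * (u $ w - u $ z)\<bar>"
      using measure_pos[of z] by (simp add: laplacian_def abs_mult)
    also have "\<dots> \<le> (1 / \<mu> z) * (\<Sum>w | (z, w) \<in> E. \<omega> z w * (2 * M))"
    proof (intro mult_left_mono sum_abs[THEN order_trans] sum_mono)
      fix w
      have "\<bar>u $ w - u $ z\<bar> \<le> 2 * M" using u[of w] u[of z] by linarith
      then show "\<bar>\<omega> z w * (u $ w - u $ z)\<bar> \<le> \<omega> z w * (2 * M)"
        using weight_nonneg[of z w] by (simp add: abs_mult mult_left_mono)
    qed (use measure_pos[of z] in simp)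
    also have "\<dots> = (1 / \<mu> z) * (\<Sum>w | (z, w) \<in> E. \<omega> z w * 2) * M"
      by (simp add: sum_distrib_right mult.assoc)
    also have "\<dots> \<le> D * M"
      unfolding D_def using M D_term by (intro mult_right_mono member_le_sum) auto
    finally show ?thesis .
  qed
  define L where "L = \<beta> * exp C + \<bar>c\<bar>"
  have L: "L \<ge> 0" using \<beta>(1) by (simp add: L_def)
  show ?thesis
  proof
    fix t and u :: "real ^ 'v" and x0
    assume t: "0 \<le> t" "t \<le> 1" and u: "\<And>w. \<bar>u $ w\<bar> \<le> u $ x0"
      and zero: "sinh_gordon_map E \<omega> \<mu> hp hm c u +
        t *\<^sub>R (decoupled_map hp hm u - sinh_gordon_map E \<omega> \<mu> hp hm c u) = 0"
    define M where "M = u $ x0"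
    have M: "M \<ge> 0" using u[of x0] by (simp add: M_def)
    have uM: "u $ w \<le> M" for w using u[of w] by (simp add: M_def)
    have eq: "(1 - t) * - (laplacian E \<omega> \<mu> u $ x) =
        a t x * exp (u $ x) + b t x * exp (- (u $ x)) - (1 - t) * c" for x
    proof -
      have "(sinh_gordon_map E \<omega> \<mu> hp hm c u +
        t *\<^sub>R (decoupled_map hp hm u - sinh_gordon_map E \<omega> \<mu> hp hm c u)) $ x = 0"
        by (simp only: zero zero_index)
      then show ?thesis
        by (simp add: decoupled_map_nth sinh_gordon_map_def a_def b_def algebra_simps)
    qed
    have tc: "\<bar>(1 - t) * c\<bar> \<le> \<bar>c\<bar>" using t by (simp add: abs_mult mult_left_le_one_le)
    have bexp: "\<bar>b t x * exp (- (u $ x))\<bar> \<le> \<beta> * exp (- (u $ x))" for x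
      using b_le[OF t, of x] by (simp add: abs_mult)
    have "\<exists>z. (hp z \<noteq> 0 \<or> t \<ge> 1/2) \<and> u $ z \<ge> M - C"
    proof (cases "t \<ge> 1/2")
      case True
      then show ?thesis using C(1) by (intro exI[of _ x0]) (simp add: M_def)
    next
      case False
      have "- (laplacian E \<omega> \<mu> u $ y) \<le> K * exp (- (u $ y)) + K" if "hp y = 0" for y
      proof -
        let ?l = "- (laplacian E \<omega> \<mu> u $ y)"
        have "a t y * exp (u $ y) \<le> 0" using that t by (simp add: a_def)
        then have l1: "(1 - t) * ?l \<le> \<beta> * exp (- (u $ y)) + \<bar>c\<bar>"
          using eq[of y] bexp[of y] tc by linarith
        have l2: "?l \<le> 2 * ((1 - t) * ?l)" if "?l \<ge> 0"
          using mult_right_mono[of "1/2" "1 - t" ?l] that False by linarith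
        have "?l \<le> 2 * (\<beta> * exp (- (u $ y)) + \<bar>c\<bar>)" if "?l \<ge> 0"
          by (rule order_trans[OF l2[OF that] mult_left_mono[OF l1]]) simp
        then have "?l \<le> max 0 (2 * (\<beta> * exp (- (u $ y)) + \<bar>c\<bar>))"
          unfolding le_max_iff_disj by linarith
        also have "\<dots> = (2 * \<beta>) * exp (- (u $ y)) + 2 * \<bar>c\<bar>" using \<beta>(1) by simp
        also have "\<dots> \<le> K * exp (- (u $ y)) + K"
          unfolding K_def using \<beta>(1) by (intro add_mono mult_right_mono) auto
        finally show ?thesis .
      qed
      then obtain z where "hp z \<noteq> 0" "u $ z \<ge> u $ x0 - C"
        using C(2)[of u x0] M uM unfolding M_def by blast
      then show ?thesis unfolding M_def by blast
    qed
    then obtain z where z: "hp z \<noteq> 0 \<or> t \<ge> 1/2" "u $ z \<ge> M - C" by blast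
    have "\<delta> * exp (M - C) \<le> \<bar>a t z\<bar> * exp (u $ z)"
      using active[OF t z(1)] z(2) \<delta>(1) by (intro mult_mono) auto
    also have "\<dots> = \<bar>a t z * exp (u $ z)\<bar>" by (simp add: abs_mult)
    also have "\<dots> \<le> \<bar>(1 - t) * - (laplacian E \<omega> \<mu> u $ z)\<bar> + \<beta> * exp (- (u $ z)) + \<bar>c\<bar>"
      using eq[of z] bexp[of z] tc by linarith
    also have "\<dots> \<le> D * M + \<beta> * exp C + \<bar>c\<bar>"
    proof (intro add_mono order_refl)
      have "\<bar>(1 - t) * - (laplacian E \<omega> \<mu> u $ z)\<bar> \<le> \<bar>laplacian E \<omega> \<mu> u $ z\<bar>"
        using t by (simp add: abs_mult mult_left_le_one_le)
      also have "\<dots> \<le> D * M" by (rule lap) (simp add: M_def u)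
      finally show "\<bar>(1 - t) * - (laplacian E \<omega> \<mu> u $ z)\<bar> \<le> D * M" .
      have "- (u $ z) \<le> C" using z(2) M by linarith
      then show "\<beta> * exp (- (u $ z)) \<le> \<beta> * exp C" using \<beta>(1) by (intro mult_left_mono) auto
    qed
    finally have "\<delta> * exp (M - C) \<le> D * M + L" by (simp add: L_def)
    then show "u $ x0 \<le> C + 2 * D / \<delta> + 2 * (D * C + L) / \<delta> + 1"
      using exp_dominates_linear[OF \<delta>(1) D L C(1) M] by (simp add: M_def)
  qed
qed

text \<open>The maximum of \<open>\<bar>u\<bar>\<close> is a value of \<open>u\<close> or of
  \<open>- u\<close>; the second case reduces to the first by the reflection symmetry.\<close>

lemma homotopy_zeros_bounded:
  fixes hp hm :: "'v::finite \<Rightarrow> real"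
  assumes G: "weighted_graph E \<omega> \<mu>" and hp: "\<exists>x. hp x \<noteq> 0" and hm: "\<exists>x. hm x \<noteq> 0"
  obtains R where "\<And>t u. \<lbrakk>0 \<le> t; t \<le> 1;
      sinh_gordon_map E \<omega> \<mu> hp hm c u +
        t *\<^sub>R (decoupled_map hp hm u - sinh_gordon_map E \<omega> \<mu> hp hm c u) = 0\<rbrakk> \<Longrightarrow> infnorm u \<le> R"
proof -
  obtain R1 where R1: "\<And>t u x0. \<lbrakk>0 \<le> t; t \<le> 1;
      sinh_gordon_map E \<omega> \<mu> hp hm c u +
        t *\<^sub>R (decoupled_map hp hm u - sinh_gordon_map E \<omega> \<mu> hp hm c u) = 0;
      \<And>w. \<bar>u $ w\<bar> \<le> u $ x0\<rbrakk> \<Longrightarrow> u $ x0 \<le> R1"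
    by (rule homotopy_zeros_one_sided_bound[where hp = hp and hm = hm and c = c, OF G hp]) blast
  have hm': "\<exists>x. - hm x \<noteq> 0" using hm by simp
  obtain R2 where R2: "\<And>t u x0. \<lbrakk>0 \<le> t; t \<le> 1;
      sinh_gordon_map E \<omega> \<mu> (\<lambda>x. - hm x) (\<lambda>x. - hp x) (- c) u +
        t *\<^sub>R (decoupled_map (\<lambda>x. - hm x) (\<lambda>x. - hp x) u -
          sinh_gordon_map E \<omega> \<mu> (\<lambda>x. - hm x) (\<lambda>x. - hp x) (- c) u) = 0;
      \<And>w. \<bar>u $ w\<bar> \<le> u $ x0\<rbrakk> \<Longrightarrow> u $ x0 \<le> R2"
    by (rule homotopy_zeros_one_sided_bound[where hp = "\<lambda>x. - hm x" and hm = "\<lambda>x. - hp x"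
          and c = "- c", OF G hm']) blast
  show ?thesis
  proof
    fix t and u :: "real ^ 'v"
    assume t: "0 \<le> t" "t \<le> 1" and zero: "sinh_gordon_map E \<omega> \<mu> hp hm c u +
        t *\<^sub>R (decoupled_map hp hm u - sinh_gordon_map E \<omega> \<mu> hp hm c u) = 0"
    have "Max ((\<lambda>x. \<bar>u $ x\<bar>) ` UNIV) \<in> (\<lambda>x. \<bar>u $ x\<bar>) ` UNIV" by (rule Max_in) auto
    then obtain x0 where "Max ((\<lambda>x. \<bar>u $ x\<bar>) ` UNIV) = \<bar>u $ x0\<bar>" by blast
    then have x0: "\<bar>u $ w\<bar> \<le> \<bar>u $ x0\<bar>" for w
      by (metis Max_ge finite finite_imageI rangeI)
    have "infnorm u \<le> \<bar>u $ x0\<bar>"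
      unfolding infnorm_Max using x0 by (auto simp: Basis_vec_def inner_axis)
    also have "\<dots> \<le> max R1 R2"
    proof (cases "u $ x0 \<ge> 0")
      case True
      then have "u $ x0 \<le> R1" using x0 by (intro R1[OF t zero]) (metis abs_of_nonneg)
      then show ?thesis using True by simp
    next
      case False
      have zero': "sinh_gordon_map E \<omega> \<mu> (\<lambda>x. - hm x) (\<lambda>x. - hp x) (- c) (- u) +
          t *\<^sub>R (decoupled_map (\<lambda>x. - hm x) (\<lambda>x. - hp x) (- u) -
            sinh_gordon_map E \<omega> \<mu> (\<lambda>x. - hm x) (\<lambda>x. - hp x) (- c) (- u)) =
          - (sinh_gordon_map E \<omega> \<mu> hp hm c u +
            t *\<^sub>R (decoupled_map hp hm u - sinh_gordon_map E \<omega> \<mu> hp hm c u))"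
        by (simp add: sinh_gordon_map_uminus decoupled_map_uminus algebra_simps)
      have "(- u) $ x0 \<le> R2"
      proof (rule R2[OF t])
        show "\<bar>(- u) $ w\<bar> \<le> (- u) $ x0" for w using x0[of w] False by simp
      qed (simp only: zero' zero minus_zero)
      then show ?thesis using False by simp
    qed
    finally show "infnorm u \<le> max R1 R2" .
  qed
qed

section \<open>The degree on large balls\<close>

lemma open_Linf_ball: "open (Linf_ball R)"
  unfolding Linf_ball_def by (intro open_Collect_less continuous_intros continuous_on_infnorm)

lemma bounded_Linf_ball: "bounded (Linf_ball R)"
proof (rule boundedI)
  fix u :: "real ^ 'a" assume "u \<in> Linf_ball R"
  then have "sqrt DIM(real ^ 'a) * infnorm u \<le> sqrt DIM(real ^ 'a) * R"
    by (intro mult_left_mono) (auto simp: Linf_ball_def)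
  then show "norm u \<le> sqrt DIM(real ^ 'a) * R" using norm_le_infnorm[of u] by linarith
qed

lemma infnorm_frontier_Linf_ball: "u \<in> frontier (Linf_ball R) \<Longrightarrow> infnorm u \<ge> R"
  using interior_open[OF open_Linf_ball[of R]] by (auto simp: frontier_def Linf_ball_def)

text \<open>Beyond the a priori bound the segment to the decoupled map has no zero on the sphere, so
  the degree is constant in \<open>R\<close> from there on. Convergence is asserted along with the
  value because \<open>Lim\<close> alone does not express that the limit exists.\<close>

theorem theorem2p2:
  fixes E :: "('v::finite \<times> 'v) set"
    and \<omega> :: "'v \<Rightarrow> 'v \<Rightarrow> real"
    and \<mu> hp hm :: "'v \<Rightarrow> real"
    and c :: real
  assumes "weighted_graph E \<omega> \<mu>"
    and "\<exists>x. hp x \<noteq> 0"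
    and "\<exists>x. hm x \<noteq> 0"
  shows "((\<lambda>R. brouwer_degree (sinh_gordon_map E \<omega> \<mu> hp hm c) (Linf_ball R) 0)
            \<longlongrightarrow> sinh_gordon_degree E \<omega> \<mu> hp hm c) at_top
    \<and> sinh_gordon_degree E \<omega> \<mu> hp hm c =
        (if {x. hp x > 0} = {x. hm x < 0} then (- 1) ^ card {x. hp x > 0} else 0)"
proof -
  let ?f = "sinh_gordon_map E \<omega> \<mu> hp hm c" and ?g = "decoupled_map hp hm"
  define d :: int where
    "d = (if {x. hp x > 0} = {x. hm x < 0} then (- 1) ^ card {x. hp x > 0} else 0)"
  obtain R0 where R0: "\<And>t u. \<lbrakk>0 \<le> t; t \<le> 1; ?f u + t *\<^sub>R (?g u - ?f u) = 0\<rbrakk> \<Longrightarrow> infnorm u \<le> R0"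
    by (rule homotopy_zeros_bounded[where c = c, OF assms]) blast
  have C2: "C2_on ?f S" "C2_on ?g S" for S
    unfolding decoupled_map_def by (rule C2_on_sinh_gordon_map)+
  \<comment> \<open>\<open>R > R0\<close> keeps zeros off the frontier; \<open>R > 0\<close> puts
    the only possible zero of the decoupled map inside the ball.\<close>
  have deg: "brouwer_degree ?f (Linf_ball R) 0 = d" if R: "R > max R0 0" for R
  proof (rule brouwer_degree_homotopy_eq[OF open_Linf_ball bounded_Linf_ball
        C2_on_continuous_on[OF C2(1)] C2_on_continuous_on[OF C2(2)] C2])
    show "regular_value ?g (Linf_ball R) 0"
      unfolding regular_value_def
    proof (intro ballI impI)
      fix u assume "?g u = 0"
      then have "{x. hp x > 0} = {x. hm x < 0}" "u = 0" by (simp_all add: decoupled_map_eq_0_iff)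
      then have "sgn (jacobian_det ?g u) \<noteq> 0" by (simp add: sgn_jacobian_decoupled_map)
      then show "jacobian_det ?g u \<noteq> 0" by (simp add: sgn_0_0)
    qed
    show "?f u + t *\<^sub>R (?g u - ?f u) \<noteq> 0"
      if "u \<in> frontier (Linf_ball R)" "0 \<le> t" "t \<le> 1" for u t
      using R0[OF that(2,3)] infnorm_frontier_Linf_ball[OF that(1)] R by fastforce
    show "of_int d = (\<Sum>u | u \<in> Linf_ball R \<and> ?g u = 0. sgn (jacobian_det ?g u))"
    proof (cases "{x. hp x > 0} = {x. hm x < 0}")
      case True
      then have "{u. u \<in> Linf_ball R \<and> ?g u = 0} = {0}"
        using R by (auto simp: decoupled_map_eq_0_iff Linf_ball_def infnorm_0)
      then show ?thesis using True by (simp add: d_def sgn_jacobian_decoupled_map)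
    next
      case False
      then show ?thesis by (simp add: d_def decoupled_map_eq_0_iff)
    qed
  qed
  have lim: "((\<lambda>R. brouwer_degree ?f (Linf_ball R) 0) \<longlongrightarrow> d) at_top"
    using eventually_gt_at_top[of "max R0 0"]
    by (intro tendsto_eventually) (auto elim!: eventually_mono simp: deg)
  then have "sinh_gordon_degree E \<omega> \<mu> hp hm c = d"
    unfolding sinh_gordon_degree_def by (intro tendsto_Lim) auto
  then show ?thesis using lim by (simp add: d_def)
qed

end
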